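(* Let $m,n$ be positive integers with $m\ge 2n$, $m$ even and $n$ odd. Then the set $\operatorname{ext}(\mathsf B^h_{m,n})$ of extreme points of $\mathsf B^h_{m,n}$ consists exactly of the points $$\pm(1,0,0),\qquad \pm(0,0,1),$$ $$\pm\left(a,\ \pm J_{m,n}\frac{(1-a)^{\frac{m-n}{m}}a^{\frac{m-n}{m}}}{\left((1-a)^{\frac{m-n}{n}}+a^{\frac{m-n}{n}}\right)^{\frac nm}},\ -\frac{a^{\frac{m-n}{n}}}{(1-a)^{\frac{m-n}{n}}+a^{\frac{m-n}{n}}}\right),\qquad a\in[a_1,1],$$ and $$\pm\left(a,\ \pm\left(1-|a+\Gamma_{m,n}(a)|\right),\ \Gamma_{m,n}(a)\right),\qquad a\in\left[\tfrac nm,a_1\right],$$ where all combinations of signs are allowed, and $J_{m,n}$, $a_1$, $\Gamma_{m,n}$ are as defined in the context.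
   Context: For $(a,b,c)\in\mathbb R^3$, $|||(a,b,c)|||_{m,n}=\sup\{|ax^m+bx^{m-n}y^n+cy^m| : (x,y)\in[-1,1]^2\}$, and $\mathsf B^h_{m,n}=\{(a,b,c)\in\mathbb R^3: |||(a,b,c)|||_{m,n}\le1\}$ is the closed unit ball. Put $J_{m,n}=\frac mn\left(\frac{n}{m-n}\right)^{\frac{m-n}{m}}$ and $\lambda_0=\frac{n}{m-n}$, and consider the equation $$(\ast)\qquad J_{m,n}(1-a)^{\frac{m-n}{m}}|c|^{\frac nm}-1-a-c=0 .$$ Let $(a_1,c_1)$ be the unique point with $a_1\le1$, $c_1<0$ satisfying $(\ast)$ and $c_1=\lambda_0a_1-1$; one has $\frac nm\le a_1<1$. For $a\in[\frac nm,a_1]$, $\Gamma_{m,n}(a)$ denotes the unique negative $c$ satisfying $(\ast)$. *)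

theory Defs
  imports "HOL-Analysis.Analysis"
begin

text \<open>
  The triple \<open>(a, b, c)\<close> stands for the homogeneous trinomial
  \<open>a x^m + b x^(m-n) y^n + c y^m\<close>. Throughout, \<open>n \<le> m\<close> is intended, so that
  the subtraction \<open>m - n\<close> on natural numbers in the exponent is the true one.
\<close>

definition trinom_norm :: "nat \<Rightarrow> nat \<Rightarrow> real \<times> real \<times> real \<Rightarrow> real" where
  "trinom_norm m n = (\<lambda>(a, b, c).
     (SUP (x, y) \<in> {-1..1} \<times> {-1..1}. \<bar>a * x ^ m + b * x ^ (m - n) * y ^ n + c * y ^ m\<bar>))"

definition trinom_ball :: "nat \<Rightarrow> nat \<Rightarrow> (real \<times> real \<times> real) set" where
  "trinom_ball m n = {p. trinom_norm m n p \<le> 1}"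

definition J :: "nat \<Rightarrow> nat \<Rightarrow> real" where
  "J m n = (real m / real n) *
     (real n / (real m - real n)) powr ((real m - real n) / real m)"

definition lambda0 :: "nat \<Rightarrow> nat \<Rightarrow> real" where
  "lambda0 m n = real n / (real m - real n)"

text \<open>
  The relation below is used only for \<open>a \<le> 1\<close> and \<open>c < 0\<close>, where the bases of \<open>powr\<close>
  are nonnegative and (for \<open>0 < n < m\<close>) its convention \<open>0 powr r = 0\<close> is the usual value
  for the positive exponents that occur.
\<close>

definition star_eq :: "nat \<Rightarrow> nat \<Rightarrow> real \<Rightarrow> real \<Rightarrow> bool" where
  "star_eq m n a c \<longleftrightarrow>
     J m n * (1 - a) powr ((real m - real n) / real m) * \<bar>c\<bar> powr (real n / real m)
       - 1 - a - c = 0"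

definition crit_point :: "nat \<Rightarrow> nat \<Rightarrow> real \<times> real" where
  "crit_point m n = (THE (a, c). a \<le> 1 \<and> c < 0 \<and> star_eq m n a c \<and> c = lambda0 m n * a - 1)"

definition a1 :: "nat \<Rightarrow> nat \<Rightarrow> real" where
  "a1 m n = fst (crit_point m n)"

definition Gam :: "nat \<Rightarrow> nat \<Rightarrow> real \<Rightarrow> real" where
  "Gam m n a = (THE c. c < 0 \<and> star_eq m n a c)"

definition b_upper :: "nat \<Rightarrow> nat \<Rightarrow> real \<Rightarrow> real" where
  "b_upper m n a =
     J m n * ((1 - a) powr ((real m - real n) / real m) * a powr ((real m - real n) / real m)
       / ((1 - a) powr ((real m - real n) / real n) + a powr ((real m - real n) / real n))
           powr (real n / real m))"

definition c_upper :: "nat \<Rightarrow> nat \<Rightarrow> real \<Rightarrow> real" where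
  "c_upper m n a =
     - (a powr ((real m - real n) / real n)
        / ((1 - a) powr ((real m - real n) / real n) + a powr ((real m - real n) / real n)))"

end

theory Submission
  imports Defs
begin

text \<open>
  Put \<open>q = n / m\<close>, \<open>s = |x|^m\<close>, \<open>t = |y|^m\<close>. As \<open>m\<close> is even and \<open>n\<close> is odd, flipping the sign
  of \<open>y\<close> flips the middle term only, so the ball is given by
  \<open>|a s + c t| + |b| s^(1-q) t^q \<le> 1\<close> on the unit square. For \<open>a \<ge> 0\<close> and \<open>c = -g \<le> 0\<close> only the
  edges \<open>s = 1\<close> and \<open>t = 1\<close> matter, and the conditions read \<open>|b| \<le> G1\<close> and \<open>|b| \<le> G2\<close> with
  \<open>G1 = inf_t ((1-a) + g t) / t^q\<close> and \<open>G2 = inf_s ((1-g) + a s) / s^(1-q)\<close>. Each infimum is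
  either a multiple of a weighted geometric mean or linear, and it is homogeneous about
  \<open>(1, 0, 0)\<close> and \<open>(0, 0, -1)\<close>, respectively; hence extreme points off the edges lie where
  \<open>G1 = G2\<close>. Conversely, at such a point with \<open>G1\<close> geometric, a segment in the ball centred at
  that point satisfies both touching conditions and the stationarity condition of the first
  infimum at its ends, and these linear equations force it to be trivial. The curve \<open>G1 = G2\<close>
  changes regime exactly at \<open>a1\<close>, by monotonicity along the line \<open>c = lambda0 a - 1\<close>.
\<close>

section \<open>The envelope of the constraints\<close>

text \<open>Concavity: the right side is the tangent line of \<open>r powr q\<close> at
  \<open>r = 1\<close>, obtained from Young's inequality against 1.\<close>

lemma powr_le_tangent:
  fixes r q :: real
  assumes "0 < q" "q < 1" "0 \<le> r"
  shows "r powr q \<le> q * r + (1 - q)"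
proof (cases "r = 0")
  case False
  then show ?thesis
    using Youngs_inequality_0[of q "1 - q" r 1] assms by simp
qed (use assms in auto)

text \<open>For positive \<open>A\<close> and \<open>g\<close>, \<open>envarg q A g\<close> is the minimizer of
  \<open>(A + g * t) / t powr q\<close> over \<open>0 < t \<le> 1\<close>, and \<open>env q A g\<close> is the minimum.\<close>

definition envarg :: "real \<Rightarrow> real \<Rightarrow> real \<Rightarrow> real" where
  "envarg q A g = min 1 (q * A / ((1 - q) * g))"

definition env :: "real \<Rightarrow> real \<Rightarrow> real \<Rightarrow> real" where
  "env q A g = (A + g * envarg q A g) / envarg q A g powr q"

text \<open>The constant of weighted AM-GM: the infimum of \<open>(A + g * t) / t powr q\<close>
  over all positive \<open>t\<close> is this factor times \<open>A powr (1 - q) * g powr q\<close>.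
  For \<open>q = n / m\<close> it equals \<open>J m n\<close>.\<close>

definition geo_const :: "real \<Rightarrow> real" where
  "geo_const q = 1 / (q powr q * (1 - q) powr (1 - q))"

lemma geo_const_pos: "0 < q \<Longrightarrow> q < 1 \<Longrightarrow> 0 < geo_const q"
  by (simp add: geo_const_def)

lemma geo_const_swap: "geo_const (1 - q) = geo_const q"
  by (simp add: geo_const_def mult.commute)

lemma envarg_bounds:
  assumes "0 < q" "q < 1" "0 < A" "0 < g"
  shows "0 < envarg q A g" "envarg q A g \<le> 1"
  using assms by (auto simp: envarg_def min_def)

lemma env_pos:
  assumes "0 < q" "q < 1" "0 < A" "0 < g"
  shows "0 < env q A g"
  using envarg_bounds[OF assms] assms by (simp add: env_def add_pos_pos)

lemma env_touch:
  assumes "0 < q" "q < 1" "0 < A" "0 < g"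
  shows "env q A g * envarg q A g powr q = A + g * envarg q A g"
  using envarg_bounds[OF assms] by (simp add: env_def)

text \<open>Writing \<open>t = r * u\<close> with \<open>u\<close> the minimizer reduces the claim
  to the tangent inequality at \<open>r = 1\<close> plus a first-order remainder whose sign is
  controlled by the choice of \<open>u\<close>.\<close>

lemma le_env_iff:
  assumes "0 < q" "q < 1" "0 < A" "0 < g"
  shows "(\<forall>t\<in>{0..1}. \<beta> * t powr q \<le> A + g * t) \<longleftrightarrow> \<beta> \<le> env q A g"
proof
  let ?u = "envarg q A g"
  note u = envarg_bounds[OF assms]
  show "\<beta> \<le> env q A g" if "\<forall>t\<in>{0..1}. \<beta> * t powr q \<le> A + g * t"
    using that[rule_format, of ?u] u by (simp add: env_def field_simps)
  show "\<forall>t\<in>{0..1}. \<beta> * t powr q \<le> A + g * t" if le: "\<beta> \<le> env q A g"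
  proof
    fix t :: real assume t: "t \<in> {0..1}"
    define r where "r = t / ?u"
    have tr: "t = r * ?u" and r0: "0 \<le> r" using u t by (auto simp: r_def)
    \<comment> \<open>First-order condition for \<open>u\<close>: the second factor vanishes at a
      stationary point; if \<open>u\<close> is clipped to 1, it is positive but \<open>r\<close> is
      at most 1.\<close>
    have key: "(r - 1) * (q * A - (1 - q) * g * ?u) \<le> 0"
    proof (cases "q * A / ((1 - q) * g) \<le> 1")
      case True
      then have "?u = q * A / ((1 - q) * g)" by (simp add: envarg_def)
      then show ?thesis using assms by (simp add: field_simps)
    next
      case False
      then have "?u = 1" "(1 - q) * g < q * A"
        using assms by (simp_all add: envarg_def field_simps)
      then show ?thesis using t by (simp add: r_def mult_nonpos_nonneg)
    qed
    have "\<beta> * t powr q \<le> env q A g * t powr q"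
      using le by (simp add: mult_right_mono)
    also have "\<dots> = (A + g * ?u) * r powr q"
      using env_touch[OF assms] by (simp add: tr powr_mult)
    also have "\<dots> \<le> (A + g * ?u) * (q * r + (1 - q))"
      using powr_le_tangent[OF assms(1,2) r0] u assms by (intro mult_left_mono) auto
    also have "\<dots> = A + g * t + (r - 1) * (q * A - (1 - q) * g * ?u)"
      by (simp add: tr algebra_simps)
    finally show "\<beta> * t powr q \<le> A + g * t" using key by simp
  qed
qed

lemma env_scale:
  assumes "k > 0"
  shows "env q (k * A) (k * g) = k * env q A g"
proof -
  have "envarg q (k * A) (k * g) = envarg q A g"
    using assms by (simp add: envarg_def)
  then show ?thesis by (simp add: env_def algebra_simps add_divide_distrib)
qed

text \<open>The stationary point lies at or beyond 1, so the minimizer is clipped to the endpoint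
  \<open>t = 1\<close>.\<close>

lemma env_linear:
  assumes "0 < q" "q < 1" "0 < g" "(1 - q) * g \<le> q * A"
  shows "env q A g = A + g"
  using assms by (simp add: env_def envarg_def min_def field_simps)

text \<open>The stationary point is not clipped. There the numerator is \<open>A / (1 - q)\<close>,
  and splitting \<open>A\<close> and \<open>1 - q\<close> into complementary powers gives the
  weighted geometric mean.\<close>

lemma env_geometric:
  assumes "0 < q" "q < 1" "0 < A" "0 < g" "q * A \<le> (1 - q) * g"
  shows "env q A g = geo_const q * A powr (1 - q) * g powr q"
proof -
  have u: "envarg q A g = q * A / ((1 - q) * g)"
    using assms by (simp add: envarg_def min_def field_simps)
  define p where "p = 1 - q"
  have split: "x powr q * x powr p = x" if "0 < x" for x
    using that by (simp add: p_def flip: powr_add)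
  have "A + g * (q * A / (p * g)) = A / p"
    using assms by (simp add: p_def field_simps)
  then have "env q A g = A / p / (q * A / (p * g)) powr q"
    by (simp add: env_def u p_def)
  also have "\<dots> = (A * (p powr q * g powr q)) / (p * (q powr q * A powr q))"
    by (simp add: powr_divide powr_mult)
  also have "\<dots> = (A powr q * A powr p * (p powr q * g powr q)) /
      (p powr q * p powr p * (q powr q * A powr q))"
    using split assms by (simp add: p_def)
  also have "\<dots> = geo_const q * A powr p * g powr q"
    using assms by (simp add: geo_const_def p_def)
  finally show ?thesis unfolding p_def .
qed

lemma isCont_env:
  fixes f h :: "real \<Rightarrow> real"
  assumes "0 < q" "q < 1" "isCont f x" "isCont h x" "0 < f x" "0 < h x"
  shows "isCont (\<lambda>x. env q (f x) (h x)) x"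
proof -
  have cont: "isCont (\<lambda>x. envarg q (f x) (h x)) x"
    unfolding envarg_def using assms by (intro continuous_intros) auto
  have nz: "envarg q (f x) (h x) \<noteq> 0"
    using envarg_bounds[of q "f x" "h x"] assms by simp
  show ?thesis
    using cont assms(3,4) nz unfolding env_def isCont_def
    by (intro tendsto_intros) auto
qed

text \<open>A nonnegative function vanishing at \<open>u\<close> cannot increase there from the
  left; \<open>u\<close> may be the endpoint 1, so only left neighbours are available. The
  coefficients may have any sign, as they do for perturbed points.\<close>

lemma touching_slope:
  fixes A g \<beta> q u :: real
  assumes q: "0 < q" "q < 1" and u: "0 < u" "u \<le> 1"
    and le: "\<And>t. 0 \<le> t \<Longrightarrow> t \<le> 1 \<Longrightarrow> \<beta> * t powr q \<le> A + g * t"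
    and eq: "\<beta> * u powr q = A + g * u"
  shows "(1 - q) * g * u \<le> q * A"
proof (rule ccontr)
  assume neg: "\<not> ?thesis"
  let ?f = "\<lambda>t. A + g * t - \<beta> * t powr q"
  have "(?f has_real_derivative g - \<beta> * (q * u powr (q - 1))) (at u)"
    using u by (auto intro!: derivative_eq_intros)
  \<comment> \<open>Multiplying the derivative by \<open>u\<close> lets the contact equation
    eliminate \<open>\<beta>\<close>.\<close>
  moreover have "u * (g - \<beta> * (q * u powr (q - 1))) = (1 - q) * g * u - q * A"
  proof -
    have "u * u powr (q - 1) = u powr q" using u by (simp add: powr_diff)
    then have "u * (g - \<beta> * (q * u powr (q - 1))) = g * u - q * (\<beta> * u powr q)"
      by (simp add: algebra_simps)
    then show ?thesis unfolding eq by (simp add: algebra_simps)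
  qed
  then have "0 < g - \<beta> * (q * u powr (q - 1))"
    using neg u by (metis diff_gt_0_iff_gt linorder_not_le zero_less_mult_pos)
  ultimately obtain d where d: "0 < d" "\<And>h. 0 < h \<Longrightarrow> h < d \<Longrightarrow> ?f (u - h) < ?f u"
    using DERIV_pos_inc_left by blast
  define h where "h = min (d / 2) (u / 2)"
  have "0 < h" "h < d" "h < u" using d u by (auto simp: h_def)
  then have "?f (u - h) < ?f u" "0 \<le> ?f (u - h)"
    using d le[of "u - h"] u by auto
  then show False using eq by simp
qed

section \<open>The ball in normalized coordinates\<close>

text \<open>An interior point of a segment is the centre of a smaller segment in the same direction;
  its half-length is limited by the nearer end, hence \<open>min u (1 - u)\<close> below.\<close>

lemma extreme_point_iff_no_symmetric_segment:
  fixes x :: "'a::real_vector"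
  assumes "convex S"
  shows "x extreme_point_of S \<longleftrightarrow> x \<in> S \<and> (\<forall>d. x + d \<in> S \<and> x - d \<in> S \<longrightarrow> d = 0)"
    (is "?L \<longleftrightarrow> ?R")
proof
  assume L: ?L
  have "d = 0" if d: "x + d \<in> S" "x - d \<in> S" for d
  proof (rule ccontr)
    assume "d \<noteq> 0"
    have "x + d \<noteq> x - d"
    proof
      assume "x + d = x - d"
      then have "2 *\<^sub>R d = 0" by (simp add: scaleR_2 algebra_simps)
      with \<open>d \<noteq> 0\<close> show False by simp
    qed
    moreover have "x = (1 - 1/2) *\<^sub>R (x + d) + (1/2) *\<^sub>R (x - d)"
      by (simp add: algebra_simps flip: scaleR_2)
    ultimately have "x \<in> open_segment (x + d) (x - d)"
      unfolding in_segment by (intro conjI exI[of _ "1/2"]) auto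
    with L d show False by (auto simp: extreme_point_of_def)
  qed
  with L show ?R by (auto simp: extreme_point_of_def)
next
  assume R: ?R
  have False if y: "y \<in> S" "z \<in> S" and "x \<in> open_segment y z" for y z
  proof -
    from that obtain u where u: "0 < u" "u < 1" "x = (1 - u) *\<^sub>R y + u *\<^sub>R z" and "y \<noteq> z"
      by (auto simp: in_segment)
    define e where "e = min u (1 - u)"
    have e: "0 < e" "e \<le> u" "e \<le> 1 - u" using u by (auto simp: e_def)
    have "x + e *\<^sub>R (z - y) = (1 - (u + e)) *\<^sub>R y + (u + e) *\<^sub>R z"
      "x - e *\<^sub>R (z - y) = (1 - (u - e)) *\<^sub>R y + (u - e) *\<^sub>R z"
      by (simp_all add: u(3) algebra_simps)
    moreover have "(1 - (u + e)) *\<^sub>R y + (u + e) *\<^sub>R z \<in> S"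
      "(1 - (u - e)) *\<^sub>R y + (u - e) *\<^sub>R z \<in> S"
      using assms y e u by (auto intro!: convexD)
    ultimately have "e *\<^sub>R (z - y) = 0" using R by metis
    with e \<open>y \<noteq> z\<close> show False by simp
  qed
  with R show ?L by (auto simp: extreme_point_of_def)
qed

text \<open>The parameter \<open>q\<close> is real so that exchanging \<open>s\<close> and
  \<open>t\<close> maps the family to itself, with \<open>q\<close> replaced by
  \<open>1 - q\<close>.\<close>

definition wball :: "real \<Rightarrow> (real \<times> real \<times> real) set" where
  "wball q = {(a, b, c). \<forall>s\<in>{0..1}. \<forall>t\<in>{0..1}.
     \<bar>a * s + c * t\<bar> + \<bar>b\<bar> * (s powr (1 - q) * t powr q) \<le> 1}"

lemma wballD:
  assumes "(a, b, c) \<in> wball q" "0 \<le> s" "s \<le> 1" "0 \<le> t" "t \<le> 1"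
  shows "\<bar>a * s + c * t\<bar> + \<bar>b\<bar> * (s powr (1 - q) * t powr q) \<le> 1"
  using assms by (auto simp: wball_def)

section \<open>Convexity and symmetries of the normalized ball\<close>

lemma convex_wball: "convex (wball q)"
proof (rule convexI, clarify)
  fix a b c a' b' c' u v :: real
  assume P: "(a, b, c) \<in> wball q" "(a', b', c') \<in> wball q" and u: "0 \<le> u" "0 \<le> v" "u + v = 1"
  have "\<bar>(u * a + v * a') * s + (u * c + v * c') * t\<bar> + \<bar>u * b + v * b'\<bar> * w \<le> 1"
    if st: "s \<in> {0..1}" "t \<in> {0..1}" and w: "w = s powr (1 - q) * t powr q" for s t w
  proof -
    have "0 \<le> w" by (simp add: w)
    have "\<bar>(u * a + v * a') * s + (u * c + v * c') * t\<bar> = \<bar>u * (a * s + c * t) + v * (a' * s + c' * t)\<bar>"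
      by (simp add: algebra_simps)
    also have "\<dots> \<le> u * \<bar>a * s + c * t\<bar> + v * \<bar>a' * s + c' * t\<bar>"
      using u by (metis abs_mult abs_of_nonneg abs_triangle_ineq)
    finally have 1: "\<bar>(u * a + v * a') * s + (u * c + v * c') * t\<bar> \<le>
        u * \<bar>a * s + c * t\<bar> + v * \<bar>a' * s + c' * t\<bar>" .
    have "\<bar>u * b + v * b'\<bar> \<le> u * \<bar>b\<bar> + v * \<bar>b'\<bar>"
      using u by (metis abs_mult abs_of_nonneg abs_triangle_ineq)
    then have 2: "\<bar>u * b + v * b'\<bar> * w \<le> (u * \<bar>b\<bar> + v * \<bar>b'\<bar>) * w"
      using \<open>0 \<le> w\<close> by (rule mult_right_mono)
    have 3: "u * (\<bar>a * s + c * t\<bar> + \<bar>b\<bar> * w) \<le> u * 1"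
      "v * (\<bar>a' * s + c' * t\<bar> + \<bar>b'\<bar> * w) \<le> v * 1"
      using wballD[OF P(1), of s t] wballD[OF P(2), of s t] st u
      by (intro mult_left_mono; simp add: w)+
    show ?thesis using 1 2 3 u(3) by (simp add: algebra_simps)
  qed
  then show "u *\<^sub>R (a, b, c) + v *\<^sub>R (a', b', c') \<in> wball q"
    by (simp add: wball_def)
qed

lemma extreme_wball_iff:
  "(a, b, c) extreme_point_of wball q \<longleftrightarrow> (a, b, c) \<in> wball q \<and>
    (\<forall>x y z. (a + x, b + y, c + z) \<in> wball q \<and> (a - x, b - y, c - z) \<in> wball q
      \<longrightarrow> x = 0 \<and> y = 0 \<and> z = 0)"
  by (simp add: extreme_point_iff_no_symmetric_segment[OF convex_wball] split_paired_all zero_prod_def)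

lemma wball_uminus_iff: "(- a, - b, - c) \<in> wball q \<longleftrightarrow> (a, b, c) \<in> wball q"
proof -
  have "\<bar>(- a) * s + (- c) * t\<bar> = \<bar>a * s + c * t\<bar>" for s t
    by (simp add: abs_if algebra_simps)
  then show ?thesis by (simp only: wball_def mem_Collect_eq case_prod_conv abs_minus_cancel)
qed

lemma wball_flip_iff: "(a, - b, c) \<in> wball q \<longleftrightarrow> (a, b, c) \<in> wball q"
  by (simp add: wball_def)

text \<open>Exchange \<open>s\<close> and \<open>t\<close>, then negate the linear part inside its
  absolute value. This carries every fact about the edge \<open>s = 1\<close> over to the edge
  \<open>t = 1\<close>.\<close>

lemma wball_swap_iff: "(g, b, - a) \<in> wball (1 - q) \<longleftrightarrow> (a, b, - g) \<in> wball q"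
proof -
  have "(g, b, - a) \<in> wball (1 - q)" if W: "(a, b, - g) \<in> wball q" for a g q
  proof -
    have "\<bar>g * s + (- a) * t\<bar> + \<bar>b\<bar> * (s powr (1 - (1 - q)) * t powr (1 - q)) \<le> 1"
      if "s \<in> {0..1}" "t \<in> {0..1}" for s t
    proof -
      have "\<bar>g * s + (- a) * t\<bar> = \<bar>a * t + (- g) * s\<bar>" by (simp add: abs_minus_commute)
      then show ?thesis using wballD[OF W, of t s] that by (simp add: mult.commute[of "s powr q"])
    qed
    then show ?thesis by (simp add: wball_def)
  qed
  from this[of a g q] this[of g a "1 - q"] show ?thesis by auto
qed

lemma extreme_uminus_iff:
  "(- a, - b, - c) extreme_point_of wball q \<longleftrightarrow> (a, b, c) extreme_point_of wball q"
proof -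
  have "(- a, - b, - c) extreme_point_of wball q" if "(a, b, c) extreme_point_of wball q" for a b c
    unfolding extreme_wball_iff
  proof (intro conjI allI impI)
    fix x y z
    assume "(- a + x, - b + y, - c + z) \<in> wball q \<and> (- a - x, - b - y, - c - z) \<in> wball q"
    then have "(a - x, b - y, c - z) \<in> wball q" "(a + x, b + y, c + z) \<in> wball q"
      using wball_uminus_iff[of "a - x" "b - y" "c - z"] wball_uminus_iff[of "a + x" "b + y" "c + z"]
      by auto
    then show "x = 0" "y = 0" "z = 0" using that by (auto simp: extreme_wball_iff)
  qed (use that in \<open>auto simp: extreme_wball_iff wball_uminus_iff\<close>)
  from this[of a b c] this[of "-a" "-b" "-c"] show ?thesis by auto
qed

lemma extreme_flip_iff:
  "(a, - b, c) extreme_point_of wball q \<longleftrightarrow> (a, b, c) extreme_point_of wball q"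
proof -
  have "(a, - b, c) extreme_point_of wball q" if "(a, b, c) extreme_point_of wball q" for b
    unfolding extreme_wball_iff
  proof (intro conjI allI impI)
    fix x y z
    assume "(a + x, - b + y, c + z) \<in> wball q \<and> (a - x, - b - y, c - z) \<in> wball q"
    then have "(a + x, b + - y, c + z) \<in> wball q" "(a - x, b - - y, c - z) \<in> wball q"
      using wball_flip_iff[of "a + x" "b - y" "c + z"] wball_flip_iff[of "a - x" "b + y" "c - z"]
      by auto
    then have "x = 0 \<and> - y = 0 \<and> z = 0" using that unfolding extreme_wball_iff by blast
    then show "x = 0" "y = 0" "z = 0" by auto
  qed (use that in \<open>auto simp: extreme_wball_iff wball_flip_iff\<close>)
  from this[of b] this[of "-b"] show ?thesis by auto
qed

section \<open>Membership in the ball, reduced to edges of the unit square\<close>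

lemma powr_le_one: "0 \<le> x \<Longrightarrow> x \<le> 1 \<Longrightarrow> 0 \<le> r \<Longrightarrow> x powr r \<le> (1::real)"
  by (simp add: powr_le1)

lemma wball_same_sign:
  assumes "0 < q" "q < 1" "0 \<le> a" "0 \<le> c" "a + \<bar>b\<bar> + c \<le> 1"
  shows "(a, b, c) \<in> wball q"
proof -
  have "\<bar>a * s + c * t\<bar> + \<bar>b\<bar> * (s powr (1 - q) * t powr q) \<le> 1"
    if st: "s \<in> {0..1}" "t \<in> {0..1}" for s t
  proof -
    have "\<bar>a * s + c * t\<bar> \<le> a + c"
      using assms st by (simp add: add_mono mult_left_le)
    moreover have "s powr (1 - q) * t powr q \<le> 1"
      using assms st by (intro mult_le_one powr_le_one) auto
    then have "\<bar>b\<bar> * (s powr (1 - q) * t powr q) \<le> \<bar>b\<bar>"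
      by (simp add: mult_left_le)
    ultimately show ?thesis using assms by linarith
  qed
  then show ?thesis by (simp add: wball_def)
qed

lemma wball_sum_le: "(a, b, c) \<in> wball q \<Longrightarrow> \<bar>a + c\<bar> + \<bar>b\<bar> \<le> 1"
  using wballD[of a b c q 1 1] by simp

lemma wball_left_le: "(a, b, c) \<in> wball q \<Longrightarrow> \<bar>a\<bar> \<le> 1"
  using wballD[of a b c q 1 0] by simp

lemma wball_right_le: "(a, b, c) \<in> wball q \<Longrightarrow> \<bar>c\<bar> \<le> 1"
  using wballD[of a b c q 0 1] by simp

text \<open>The condition on the edge \<open>s = 1\<close>. The form with \<open>b\<close> itself is
  linear in the coefficients, which suits perturbation arguments.\<close>

lemma wball_opposite_sign_left:
  assumes "(a, b, - g) \<in> wball q" "0 \<le> t" "t \<le> 1"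
  shows "b * t powr q \<le> (1 - a) + g * t" "\<bar>b\<bar> * t powr q \<le> (1 - a) + g * t"
proof -
  show "\<bar>b\<bar> * t powr q \<le> (1 - a) + g * t"
    using wballD[OF assms(1), of 1 t] assms by (simp add: abs_if split: if_splits)
  moreover have "b * t powr q \<le> \<bar>b\<bar> * t powr q" by (auto intro: mult_right_mono)
  ultimately show "b * t powr q \<le> (1 - a) + g * t" by simp
qed

lemma wball_opposite_sign_right:
  assumes "(a, b, - g) \<in> wball q" "0 \<le> s" "s \<le> 1"
  shows "b * s powr (1 - q) \<le> (1 - g) + a * s" "\<bar>b\<bar> * s powr (1 - q) \<le> (1 - g) + a * s"
  using wball_opposite_sign_left[of g b a "1 - q" s] assms wball_swap_iff by auto

text \<open>Where \<open>a * s - g * t\<close> is nonnegative, raising \<open>s\<close> to 1 only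
  increases the left side; where it is negative, raising \<open>t\<close> to 1 does.\<close>

lemma wball_opposite_sign_iff:
  assumes "0 < q" "q < 1" "0 \<le> a" "0 \<le> g"
  shows "(a, b, - g) \<in> wball q \<longleftrightarrow>
    (\<forall>t\<in>{0..1}. \<bar>b\<bar> * t powr q \<le> (1 - a) + g * t) \<and>
    (\<forall>s\<in>{0..1}. \<bar>b\<bar> * s powr (1 - q) \<le> (1 - g) + a * s)" (is "_ \<longleftrightarrow> ?R")
proof
  show ?R if "(a, b, - g) \<in> wball q"
    using wball_opposite_sign_left(2)[OF that] wball_opposite_sign_right(2)[OF that] by auto
next
  assume R: ?R
  have "\<bar>a * s + (- g) * t\<bar> + \<bar>b\<bar> * (s powr (1 - q) * t powr q) \<le> 1"
    if st: "s \<in> {0..1}" "t \<in> {0..1}" for s t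
  proof -
    have "s powr (1 - q) \<le> 1" "t powr q \<le> 1"
      using assms st by (auto intro!: powr_le_one)
    then have "\<bar>b\<bar> * (s powr (1 - q) * t powr q) \<le> \<bar>b\<bar> * t powr q"
      "\<bar>b\<bar> * (s powr (1 - q) * t powr q) \<le> \<bar>b\<bar> * s powr (1 - q)"
      by (auto intro!: mult_left_mono simp: mult_left_le mult_left_le_one_le)
    moreover have "a * s \<le> a" "g * t \<le> g" using assms st by (auto simp: mult_left_le)
    moreover have "\<bar>b\<bar> * t powr q \<le> (1 - a) + g * t" "\<bar>b\<bar> * s powr (1 - q) \<le> (1 - g) + a * s"
      using R st by auto
    ultimately show ?thesis by (simp add: abs_if)
  qed
  then show "(a, b, - g) \<in> wball q" by (simp add: wball_def)
qed

lemma wball_env_iff: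
  assumes "0 < q" "q < 1" "0 < a" "a < 1" "0 < g" "g < 1"
  shows "(a, b, - g) \<in> wball q \<longleftrightarrow>
    \<bar>b\<bar> \<le> env q (1 - a) g \<and> \<bar>b\<bar> \<le> env (1 - q) (1 - g) a"
  using assms le_env_iff[of q "1 - a" g "\<bar>b\<bar>"] le_env_iff[of "1 - q" "1 - g" a "\<bar>b\<bar>"]
  by (simp add: wball_opposite_sign_iff)

lemma extreme_swap_iff:
  "(g, b, - a) extreme_point_of wball (1 - q) \<longleftrightarrow> (a, b, - g) extreme_point_of wball q"
proof -
  have "(g, b, - a) extreme_point_of wball (1 - q)" if "(a, b, - g) extreme_point_of wball q" for a g q
    unfolding extreme_wball_iff
  proof (intro conjI allI impI)
    fix x y z
    assume "(g + x, b + y, - a + z) \<in> wball (1 - q) \<and> (g - x, b - y, - a - z) \<in> wball (1 - q)"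
    then have "(a + - z, b + y, - g + - x) \<in> wball q" "(a - - z, b - y, - g - - x) \<in> wball q"
      using wball_swap_iff[of "g + x" "b + y" "a - z" q] wball_swap_iff[of "g - x" "b - y" "a + z" q]
      by (auto simp: algebra_simps)
    then have "- z = 0 \<and> y = 0 \<and> - x = 0" using that unfolding extreme_wball_iff by blast
    then show "x = 0" "y = 0" "z = 0" by auto
  qed (use that in \<open>auto simp: extreme_wball_iff wball_swap_iff\<close>)
  from this[of a g q] this[of g a "1 - q"] show ?thesis by auto
qed

section \<open>Extremality as contact with both envelopes\<close>

lemma extreme_if_touching:
  assumes q: "0 < q" "q < 1" and ag: "0 < a" "a < 1" "0 < g" "g < 1" and "0 \<le> b"
    and e1: "b = env q (1 - a) g" and e2: "b = env (1 - q) (1 - g) a"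
    and geo: "q * (1 - a) \<le> (1 - q) * g"
  shows "(a, b, - g) extreme_point_of wball q"
  unfolding extreme_wball_iff
proof (intro conjI allI impI)
  show "(a, b, - g) \<in> wball q"
    using wball_env_iff[OF q ag] e1 e2 \<open>0 \<le> b\<close> by simp
  fix x y z
  assume *: "(a + x, b + y, - g + z) \<in> wball q \<and> (a - x, b - y, - g - z) \<in> wball q"
  define u where "u = envarg q (1 - a) g"
  define v where "v = envarg (1 - q) (1 - g) a"
  have u: "0 < u" "u \<le> 1" and v: "0 < v" "v \<le> 1"
    using envarg_bounds[of q "1 - a" g] envarg_bounds[of "1 - q" "1 - g" a] q ag
    by (auto simp: u_def v_def)
  have ueq: "b * u powr q = (1 - a) + g * u" and veq: "b * v powr (1 - q) = (1 - g) + a * v"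
    using env_touch[of q "1 - a" g] env_touch[of "1 - q" "1 - g" a] q ag e1 e2
    by (auto simp: u_def v_def)
  \<comment> \<open>By \<open>geo\<close> the minimizer is not clipped, so stationarity holds with
    equality.\<close>
  have ustat: "(1 - q) * g * u = q * (1 - a)"
    using geo q ag by (simp add: u_def envarg_def min_def field_simps)
  have W: "(a + x, b + y, - (g - z)) \<in> wball q" "(a - x, b - y, - (g + z)) \<in> wball q"
    using * by simp_all
  note le1 = W[THEN wball_opposite_sign_left(1)]
  note le2 = W[THEN wball_opposite_sign_right(1), of v]
  \<comment> \<open>The constraints at \<open>u\<close> for the two ends average to the contact
    equation at the centre, so both are equalities; likewise at \<open>v\<close> for
    \<open>y2\<close>.\<close>
  have y1: "y * u powr q = - x - z * u"
    using le1[of u] u ueq by (simp add: algebra_simps)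
  have y2: "y * v powr (1 - q) = z + x * v"
    using le2 v veq by (simp add: algebra_simps)
  \<comment> \<open>Both ends touch at the same \<open>u\<close>, so the slope condition holds at
    each; subtracting stationarity at the centre leaves two opposite inequalities.\<close>
  have "(1 - q) * (g - z) * u \<le> q * (1 - (a + x))"
    using ueq y1 by (intro touching_slope[OF q u le1(1)]) (auto simp: algebra_simps)
  moreover have "(1 - q) * (g + z) * u \<le> q * (1 - (a - x))"
    using ueq y1 by (intro touching_slope[OF q u le1(2)]) (auto simp: algebra_simps)
  ultimately have xz: "q * x = (1 - q) * z * u"
    using ustat by (simp add: algebra_simps)
  have "q * (y * u powr q) = - (z * u)"
    using xz by (simp add: y1 algebra_simps)
  moreover have "q * (y * v powr (1 - q)) = q * z + (q * x) * v"
    by (simp add: y2 algebra_simps)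
  then have "q * (y * v powr (1 - q)) = z * (q + (1 - q) * u * v)"
    unfolding xz by (simp add: algebra_simps)
  ultimately have "- (z * u) * v powr (1 - q) = z * (q + (1 - q) * u * v) * u powr q"
    by (metis mult.assoc mult.commute)
  \<comment> \<open>Eliminating \<open>x\<close> and \<open>y\<close> from the three linear
    equations leaves \<open>z\<close> times a positive number.\<close>
  then have "z * ((q + (1 - q) * u * v) * u powr q + u * v powr (1 - q)) = 0"
    by (simp add: algebra_simps)
  moreover have "0 < (q + (1 - q) * u * v) * u powr q + u * v powr (1 - q)"
    using q u v by (intro add_pos_pos mult_pos_pos) auto
  ultimately show z: "z = 0" by simp
  show x: "x = 0" using xz z q by simp
  show "y = 0" using y1 x z u by simp
qed

text \<open>The envelope is homogeneous in \<open>(1 - a, g)\<close>, so a point lying on one envelope but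
  strictly below the other can be moved along the ray through \<open>(1, 0, 0)\<close>.\<close>

lemma not_extreme_below_second:
  assumes q: "0 < q" "q < 1" and ag: "0 < a" "a < 1" "0 < g" "g < 1"
    and e1: "b = env q (1 - a) g" and e2: "b < env (1 - q) (1 - g) a"
  shows "\<not> (a, b, - g) extreme_point_of wball q"
proof
  assume ext: "(a, b, - g) extreme_point_of wball q"
  have b: "0 < b" using env_pos[of q "1 - a" g] q ag e1 by simp
  \<comment> \<open>The slack in the second constraint at the point of the ray with factor
    \<open>1 + e\<close>.\<close>
  define F where "F = (\<lambda>e. env (1 - q) (1 - (1 + e) * g) (1 - (1 + e) * (1 - a)) - (1 + e) * b)"
  have "isCont F 0" unfolding F_def using q ag
    by (intro continuous_intros isCont_env) auto
  then have "F \<midarrow>0\<rightarrow> F 0" by (simp add: isCont_def)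
  moreover have "0 < F 0" using e2 by (simp add: F_def)
  ultimately have "\<forall>\<^sub>F e in at 0. 0 < F e" by (rule order_tendstoD)
  then obtain d where d: "0 < d" "\<And>e. e \<noteq> 0 \<Longrightarrow> \<bar>e\<bar> < d \<Longrightarrow> 0 < F e"
    by (auto simp: eventually_at dist_real_def)
  \<comment> \<open>Small enough to keep the factor positive, the slack positive, and both outer
    coefficients inside the open square.\<close>
  define e where "e = Min {1/2, d/2, a/2, (1 - g)/2}"
  have e: "0 < e" "e < 1" "e < d" "e < a" "e < 1 - g"
    using d ag by (auto simp: e_def min_def)
  have mem: "(1 - (1 + h) * (1 - a), (1 + h) * b, - ((1 + h) * g)) \<in> wball q"
    if h: "\<bar>h\<bar> = e" for h
  proof -
    have h': "0 < 1 + h" "h \<le> e" "h \<noteq> 0" using h e by auto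
    have "h * k \<le> e" if "0 \<le> k" "k \<le> 1" for k
      using mult_right_mono[OF h'(2) that(1)] mult_left_mono[OF that(2) less_imp_le[OF e(1)]] by linarith
    then have "h * (1 - a) \<le> e" "h * g \<le> e" using ag by auto
    then have bd: "0 < 1 - (1 + h) * (1 - a)" "(1 + h) * g < 1"
      using e by (auto simp: algebra_simps)
    have "(1 + h) * b < env (1 - q) (1 - (1 + h) * g) (1 - (1 + h) * (1 - a))"
      using d(2)[of h] h e by (simp add: F_def)
    moreover have "(1 + h) * b = env q ((1 + h) * (1 - a)) ((1 + h) * g)"
      using env_scale[OF h'(1)] e1 by simp
    moreover have "\<bar>(1 + h) * b\<bar> = (1 + h) * b" using h' b by simp
    ultimately show ?thesis
      using wball_env_iff[of q "1 - (1 + h) * (1 - a)" "(1 + h) * g" "(1 + h) * b"] q bd h' ag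
      by simp
  qed
  have "(a + (- (e * (1 - a))), b + e * b, - g + (- (e * g))) \<in> wball q"
    "(a - (- (e * (1 - a))), b - e * b, - g - (- (e * g))) \<in> wball q"
    using mem[of e] mem[of "- e"] e by (simp_all add: algebra_simps)
  with ext have "e * b = 0" unfolding extreme_wball_iff by blast
  with e b show False by simp
qed

text \<open>With slack in both constraints, the middle coefficient alone can be varied.\<close>

lemma not_extreme_below_both:
  assumes q: "0 < q" "q < 1" and ag: "0 < a" "a < 1" "0 < g" "g < 1" and "0 \<le> b"
    and "b < env q (1 - a) g" and "b < env (1 - q) (1 - g) a"
  shows "\<not> (a, b, - g) extreme_point_of wball q"
proof
  assume ext: "(a, b, - g) extreme_point_of wball q"
  define e where "e = min (env q (1 - a) g - b) (env (1 - q) (1 - g) a - b)"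
  have e: "0 < e" "b + e \<le> env q (1 - a) g" "b + e \<le> env (1 - q) (1 - g) a"
    using assms by (auto simp: e_def)
  then have "(a + 0, b + e, - g + 0) \<in> wball q" "(a - 0, b - e, - g - 0) \<in> wball q"
    using wball_env_iff[OF q ag] \<open>0 \<le> b\<close> by (auto simp: abs_if)
  with ext have "e = 0" unfolding extreme_wball_iff by blast
  with e show False by simp
qed

text \<open>The tangents at 1 of \<open>t powr q\<close> and \<open>t powr (1 - q)\<close> have
  slope at least \<open>a\<close>, so both edge conditions follow from
  \<open>\<bar>b\<bar> \<le> 1\<close>. This provides flat pieces of the sphere, used to exclude
  extreme points.\<close>

lemma antidiagonal_mem_wball:
  assumes "0 < q" "q \<le> 1/2" "0 \<le> a" "a \<le> q" "\<bar>b\<bar> \<le> 1"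
  shows "(a, b, - a) \<in> wball q"
proof -
  have *: "\<bar>b\<bar> * t powr r \<le> (1 - a) + a * t"
    if "0 < r" "r < 1" "a \<le> r" "0 \<le> t" "t \<le> 1" for r t
  proof -
    have "\<bar>b\<bar> * t powr r \<le> t powr r" using assms by (simp add: mult_left_le_one_le)
    also have "\<dots> \<le> r * t + (1 - r)" by (rule powr_le_tangent) (use that in auto)
    also have "\<dots> \<le> (1 - a) + a * t"
      using mult_nonneg_nonneg[of "r - a" "1 - t"] that by (simp add: algebra_simps)
    finally show ?thesis .
  qed
  show ?thesis
    using assms by (subst wball_opposite_sign_iff) (auto intro!: *)
qed

lemma extreme_opposite_sign_iff:
  assumes q: "0 < q" "q \<le> 1/2" and ag: "0 < a" "a < 1" "0 < g" "g < 1" and "0 \<le> b"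
  shows "(a, b, - g) extreme_point_of wball q \<longleftrightarrow>
    b = env q (1 - a) g \<and> b = env (1 - q) (1 - g) a \<and> q * (1 - a) \<le> (1 - q) * g"
    (is "?L \<longleftrightarrow> ?R")
proof
  show ?L if ?R using that extreme_if_touching[OF _ _ ag] q \<open>0 \<le> b\<close> by auto
  assume L: ?L
  have q1: "q < 1" using q by simp
  have "(a, b, - g) \<in> wball q" using L by (simp add: extreme_point_of_def)
  then have le: "b \<le> env q (1 - a) g" "b \<le> env (1 - q) (1 - g) a"
    using wball_env_iff[OF q(1) q1 ag] \<open>0 \<le> b\<close> by auto
  have "\<not> (b = env q (1 - a) g \<and> b < env (1 - q) (1 - g) a)"
    using not_extreme_below_second[OF q(1) q1 ag] L by blast
  moreover have "\<not> (b = env (1 - q) (1 - g) a \<and> b < env q (1 - a) g)"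
    using not_extreme_below_second[of "1 - q" g a b] q ag L extreme_swap_iff[of g b a q] by auto
  moreover have "\<not> (b < env q (1 - a) g \<and> b < env (1 - q) (1 - g) a)"
    using not_extreme_below_both[OF q(1) q1 ag \<open>0 \<le> b\<close>] L by blast
  ultimately have e: "b = env q (1 - a) g" "b = env (1 - q) (1 - g) a"
    using le by linarith+
  \<comment> \<open>If the first envelope is strictly in its linear regime,
    \<open>q \<le> 1/2\<close> makes the second linear too. Equality of the two values then puts the
    point inside a flat antidiagonal piece.\<close>
  have "q * (1 - a) \<le> (1 - q) * g"
  proof (rule ccontr)
    assume n: "\<not> ?thesis"
    have "q * a + (1 - q) * g \<le> 1 - q"
    proof -
      have "q * a + (1 - q) * g < q" using n by (simp add: algebra_simps)
      then show ?thesis using q by simp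
    qed
    then have "b = (1 - g) + a" using e(2) env_linear[of "1 - q" a "1 - g"] q ag
      by (simp add: algebra_simps)
    moreover have "b = (1 - a) + g" using e(1) env_linear[of q g "1 - a"] q ag n by simp
    ultimately have "g = a" "b = 1" by auto
    then have "a < q" using n by (simp add: algebra_simps)
    define e where "e = min a (q - a)"
    have e: "0 < e" "e \<le> a" "e \<le> q - a" using ag \<open>a < q\<close> by (auto simp: e_def)
    then have "(a + e, b + 0, - g + - e) \<in> wball q" "(a - e, b - 0, - g - - e) \<in> wball q"
      using antidiagonal_mem_wball[of q "a + e" b] antidiagonal_mem_wball[of q "a - e" b] q
      by (auto simp: \<open>g = a\<close> \<open>b = 1\<close>)
    with L have "e = 0" unfolding extreme_wball_iff by blast
    with e show False by simp
  qed
  with e show ?R by simp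
qed

section \<open>Classification of extreme points\<close>

text \<open>Divide by \<open>t powr q\<close> and let \<open>t\<close> tend to 0 from the right; the
  bound tends to \<open>0 powr (1 - q) = 0\<close>.\<close>

lemma powr_le_linear_imp_nonpos:
  fixes \<beta> g q :: real
  assumes "q < 1" and le: "\<And>t. 0 \<le> t \<Longrightarrow> t \<le> 1 \<Longrightarrow> \<beta> * t powr q \<le> g * t"
  shows "\<beta> \<le> 0"
proof -
  have "((\<lambda>t. g * t powr (1 - q)) \<longlongrightarrow> g * 0 powr (1 - q)) (at_right 0)"
    using assms(1) by (intro tendsto_intros) (auto simp: eventually_at_right_less eventually_at_filter)
  moreover have "\<forall>\<^sub>F t in at_right 0. \<beta> \<le> g * t powr (1 - q)"
    unfolding eventually_at_right_field
  proof (intro exI[of _ 1] conjI allI impI)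
    fix t :: real assume "0 < t" "t < 1"
    then show "\<beta> \<le> g * t powr (1 - q)"
      using le[of t] by (simp add: powr_diff field_simps)
  qed simp
  ultimately have "\<beta> \<le> g * 0 powr (1 - q)"
    by (intro tendsto_lowerbound[where F = "at_right 0"]) auto
  then show ?thesis by simp
qed

text \<open>At \<open>a = 1\<close> the edge condition loses its constant term, and near 0 a power
  below 1 dominates any linear function.\<close>

lemma wball_left_edge:
  assumes "0 < q" "q < 1" "(1, b, - g) \<in> wball q"
  shows "b = 0"
proof -
  have "\<bar>b\<bar> \<le> 0"
    using powr_le_linear_imp_nonpos[of q "\<bar>b\<bar>" g] wball_opposite_sign_left(2)[OF assms(3)] assms(2)
    by simp
  then show ?thesis by simp
qed

lemma wball_right_edge:
  assumes "0 < q" "q < 1" "(a, b, - 1) \<in> wball q"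
  shows "b = 0"
  using wball_left_edge[of "1 - q" b a] assms wball_swap_iff[of 1 b a q] by simp

lemma wball_square:
  assumes "0 < q" "q < 1" "0 \<le> a" "a \<le> 1" "0 \<le> g" "g \<le> 1"
  shows "(a, 0, - g) \<in> wball q"
  using assms by (simp add: wball_opposite_sign_iff)

lemma extreme_left_vertex:
  assumes "0 < q" "q < 1"
  shows "(1, 0, 0) extreme_point_of wball q"
  unfolding extreme_wball_iff
proof (intro conjI allI impI)
  show "(1, 0, 0) \<in> wball q" using wball_same_sign[of q 1 0 0] assms by simp
  fix x y z
  assume *: "(1 + x, 0 + y, 0 + z) \<in> wball q \<and> (1 - x, 0 - y, 0 - z) \<in> wball q"
  then have "\<bar>1 + x\<bar> \<le> 1" "\<bar>1 - x\<bar> \<le> 1" "\<bar>1 + x + z\<bar> + \<bar>y\<bar> \<le> 1" "\<bar>1 - x - z\<bar> + \<bar>y\<bar> \<le> 1"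
    using wball_left_le[of "1 + x" y z q] wball_left_le[of "1 - x" "- y" "- z" q]
      wball_sum_le[of "1 + x" y z q] wball_sum_le[of "1 - x" "- y" "- z" q] by auto
  then show "x = 0" "y = 0" "z = 0" by linarith+
qed

lemma extreme_right_vertex:
  assumes "0 < q" "q < 1"
  shows "(0, 0, 1) extreme_point_of wball q"
  using extreme_left_vertex[of "1 - q"] extreme_swap_iff[of 0 0 "- 1" "1 - q"]
    extreme_uminus_iff[of 1 0 0 "1 - q"] assms
  by simp

lemma extreme_corner:
  assumes "0 < q" "q < 1"
  shows "(1, 0, - 1) extreme_point_of wball q"
  unfolding extreme_wball_iff
proof (intro conjI allI impI)
  show "(1, 0, - 1) \<in> wball q" using wball_square[of q 1 1] assms by simp
  fix x y z
  assume *: "(1 + x, 0 + y, - 1 + z) \<in> wball q \<and> (1 - x, 0 - y, - 1 - z) \<in> wball q"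
  then have "\<bar>1 + x\<bar> \<le> 1" "\<bar>1 - x\<bar> \<le> 1" "\<bar>- 1 + z\<bar> \<le> 1" "\<bar>- 1 - z\<bar> \<le> 1"
    using wball_left_le[of "1 + x" y "- 1 + z" q] wball_left_le[of "1 - x" "- y" "- 1 - z" q]
      wball_right_le[of "1 + x" y "- 1 + z" q] wball_right_le[of "1 - x" "- y" "- 1 - z" q] by auto
  then show x: "x = 0" and z: "z = 0" by linarith+
  show "y = 0" using * wball_left_edge[of q y 1] assms by (simp add: x z)
qed

text \<open>In the nonnegative octant the ball is the simplex \<open>a + b + c \<le> 1\<close>. Its
  vertices on the \<open>b\<close> axis are not extreme in the whole ball, which extends beyond the
  octant.\<close>

lemma extreme_same_sign:
  assumes q: "0 < q" "q \<le> 1/2" and pos: "0 \<le> a" "0 \<le> b" "0 \<le> c"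
    and ext: "(a, b, c) extreme_point_of wball q"
  shows "(a, b, c) = (1, 0, 0) \<or> (a, b, c) = (0, 0, 1)"
proof -
  have q1: "q < 1" using q by simp
  have "(a, b, c) \<in> wball q" using ext by (simp add: extreme_point_of_def)
  then have sum: "a + b + c \<le> 1" using wball_sum_le[of a b c q] pos by simp
  have rigid: "x = 0 \<and> y = 0 \<and> z = 0"
    if "\<bar>x\<bar> \<le> a" "\<bar>y\<bar> \<le> b" "\<bar>z\<bar> \<le> c" "\<bar>x + y + z\<bar> \<le> 1 - (a + b + c)" for x y z
  proof -
    have "(a + x, b + y, c + z) \<in> wball q" "(a - x, b - y, c - z) \<in> wball q"
      using that by (auto intro!: wball_same_sign q q1)
    with ext show ?thesis unfolding extreme_wball_iff by blast
  qed
  \<comment> \<open>Shifting weight between two coefficients preserves the sum, so no two of them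
    are positive.\<close>
  have ac: "min a c = 0" and ab: "min a b = 0" and bc: "min b c = 0"
    using rigid[of "min a c" 0 "- min a c"] rigid[of "min a b" "- min a b" 0]
      rigid[of 0 "min b c" "- min b c"] pos sum by auto
  have a1: "min a (1 - (a + b + c)) = 0" and c1: "min c (1 - (a + b + c)) = 0"
    using rigid[of "min a (1 - (a + b + c))" 0 0] rigid[of 0 0 "min c (1 - (a + b + c))"] pos sum
    by auto
  \<comment> \<open>Otherwise \<open>(0, b, 0)\<close> is the midpoint of an antidiagonal segment
    with ends \<open>(q, b, - q)\<close> and \<open>(- q, b, q)\<close>.\<close>
  have "\<not> (a = 0 \<and> c = 0)"
  proof
    assume "a = 0 \<and> c = 0"
    moreover have "(q, b, - q) \<in> wball q" "(q, - b, - q) \<in> wball q"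
      using antidiagonal_mem_wball[of q q b] antidiagonal_mem_wball[of q q "- b"] q pos sum by auto
    ultimately have "(a + q, b + 0, c + - q) \<in> wball q" "(a - q, b - 0, c - - q) \<in> wball q"
      using wball_uminus_iff[of q "- b" "- q" q] by auto
    with ext have "q = 0" unfolding extreme_wball_iff by blast
    with q show False by simp
  qed
  then show ?thesis using ac ab bc a1 c1 pos sum by (auto simp: min_def split: if_splits)
qed

text \<open>The sign conditions select representatives under the symmetries. The corner
  \<open>(1, 0, - 1)\<close> is listed apart because the envelope description covers the open
  square; it later becomes the end \<open>a = 1\<close> of the first arc.\<close>

lemma extreme_iff:
  assumes q: "0 < q" "q \<le> 1/2" and pos: "0 \<le> a" "0 \<le> b" "0 < a \<or> 0 \<le> c"
  shows "(a, b, c) extreme_point_of wball q \<longleftrightarrow>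
    (a, b, c) \<in> {(1, 0, 0), (0, 0, 1), (1, 0, - 1)} \<or>
    0 < a \<and> a < 1 \<and> - 1 < c \<and> c < 0 \<and>
    b = env q (1 - a) (- c) \<and> b = env (1 - q) (1 + c) a \<and> q * (1 - a) \<le> (1 - q) * (- c)"
    (is "?L \<longleftrightarrow> ?V \<or> ?C")
proof
  have q1: "q < 1" using q by simp
  have C: "?L \<longleftrightarrow> ?C" if "0 < a" "a < 1" "- 1 < c" "c < 0"
    using extreme_opposite_sign_iff[OF q that(1,2), of "- c" b] that pos by simp
  show ?L if "?V \<or> ?C"
    using that C extreme_left_vertex[OF q(1) q1] extreme_right_vertex[OF q(1) q1]
      extreme_corner[OF q(1) q1] by auto
  assume L: ?L
  then have W: "(a, b, c) \<in> wball q" by (simp add: extreme_point_of_def)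
  then have bd: "a \<le> 1" "- 1 \<le> c" using wball_left_le wball_right_le by force+
  show "?V \<or> ?C"
  proof (cases "0 \<le> c")
    case True
    then show ?thesis using extreme_same_sign[OF q pos(1,2) True L] by auto
  next
    case False
    then have a: "0 < a" and c: "c < 0" using pos by auto
    \<comment> \<open>On the sides \<open>a = 1\<close> and \<open>c = - 1\<close> the middle
      coefficient vanishes, so only ends of segments can be extreme.\<close>
    consider "a = 1" | "a < 1" "c = - 1" | "a < 1" "- 1 < c" using bd by linarith
    then show ?thesis
    proof cases
      case 1
      have b: "b = 0" using wball_left_edge[of q b "- c"] W 1 q q1 by simp
      define e where "e = min (- c) (1 + c)"
      have e: "0 \<le> e" "e \<le> - c" "e \<le> 1 + c" using c bd by (auto simp: e_def)
      have "(a + 0, b + 0, c + e) \<in> wball q" "(a - 0, b - 0, c - e) \<in> wball q"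
        using wball_square[of q 1 "- (c + e)"] wball_square[of q 1 "- (c - e)"] q q1 1 b c e
        by (auto simp: add.commute)
      with L have "e = 0" unfolding extreme_wball_iff by blast
      then have "c = - 1" using c by (auto simp: e_def min_def split: if_splits)
      then show ?thesis using 1 b by simp
    next
      case 2
      have b: "b = 0" using wball_right_edge[of q a b] W 2 q q1 by simp
      define e where "e = min a (1 - a)"
      have e: "0 < e" "e \<le> a" "e \<le> 1 - a" using a 2 by (auto simp: e_def)
      have "(a + e, b + 0, c + 0) \<in> wball q" "(a - e, b - 0, c - 0) \<in> wball q"
        using wball_square[of q "a + e" 1] wball_square[of q "a - e" 1] q q1 2 b e by auto
      with L have "e = 0" unfolding extreme_wball_iff by blast
      with e show ?thesis by simp
    next
      case 3
      then show ?thesis using C a c L by blast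
    qed
  qed
qed

section \<open>The two arcs\<close>

text \<open>The gap between the two envelopes' formulas at \<open>g = 1 - lambda0 * a\<close>, the line on which
  the second envelope changes from geometric to linear.\<close>

definition crit_gap :: "real \<Rightarrow> real \<Rightarrow> real" where
  "crit_gap q a = geo_const q * (1 - a) powr (1 - q) * (1 - q / (1 - q) * a) powr q - a / (1 - q)"

text \<open>The first identity evaluates the geometric mean at a change of regime; the second
  evaluates the gap at \<open>a = q\<close>.\<close>

lemma geo_const_powr:
  assumes "0 < q" "q < 1"
  shows "geo_const q * (q / (1 - q)) powr q = 1 / (1 - q)"
    and "geo_const q * (1 - q) powr (1 - q) = 1 / q powr q"
proof -
  have "(1 - q) powr q * (1 - q) powr (1 - q) = 1 - q"
    using assms by (simp flip: powr_add)
  then show "geo_const q * (q / (1 - q)) powr q = 1 / (1 - q)"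
    using assms by (simp add: geo_const_def powr_divide field_simps)
  show "geo_const q * (1 - q) powr (1 - q) = 1 / q powr q"
    using assms by (simp add: geo_const_def)
qed

text \<open>Both power factors decrease in \<open>a\<close>, and the subtracted term increases.
  \<open>q \<le> 1/2\<close> keeps the second base nonnegative up to \<open>a' = 1\<close>.\<close>

lemma crit_gap_strict_antimono:
  assumes q: "0 < q" "q \<le> 1/2" and a: "0 \<le> a" "a < a'" "a' \<le> 1"
  shows "crit_gap q a' < crit_gap q a"
proof -
  have "q / (1 - q) \<le> 1" "0 \<le> q / (1 - q)" using q by (auto simp: field_simps)
  then have "q / (1 - q) * a' \<le> 1" "q / (1 - q) * a \<le> q / (1 - q) * a'"
    using mult_mono[of "q / (1 - q)" 1 a' 1] mult_left_mono[of a a' "q / (1 - q)"] a by auto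
  then have "(1 - a') powr (1 - q) * (1 - q / (1 - q) * a') powr q
      \<le> (1 - a) powr (1 - q) * (1 - q / (1 - q) * a) powr q"
    using a q by (intro mult_mono powr_mono2) auto
  then have "geo_const q * ((1 - a') powr (1 - q) * (1 - q / (1 - q) * a') powr q)
      \<le> geo_const q * ((1 - a) powr (1 - q) * (1 - q / (1 - q) * a) powr q)"
    using geo_const_pos[of q] q by (intro mult_left_mono) auto
  moreover have "a / (1 - q) < a' / (1 - q)" using a q by (intro divide_strict_right_mono) auto
  ultimately show ?thesis unfolding crit_gap_def mult.assoc by linarith
qed

text \<open>Intermediate value theorem on \<open>{q..1}\<close>: at \<open>q\<close> the first term
  is at least 1 and the subtracted one is \<open>l \<le> 1\<close>; at 1 the power vanishes.\<close>

lemma crit_gap_root: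
  assumes q: "0 < q" "q \<le> 1/2"
  obtains \<alpha> where "q \<le> \<alpha>" "\<alpha> < 1" "crit_gap q \<alpha> = 0"
proof -
  define l where "l = q / (1 - q)"
  have l: "0 < l" "l \<le> 1" using q by (auto simp: l_def field_simps)
  have "l * q \<le> 1 * (1/2)" using l q by (intro mult_mono) auto
  then have "1 \<le> (1 - l * q) / q" using q by (simp add: field_simps)
  then have "1 \<le> ((1 - l * q) / q) powr q" using q by (simp add: ge_one_powr_ge_zero)
  also have "\<dots> = geo_const q * (1 - q) powr (1 - q) * (1 - l * q) powr q"
    using geo_const_powr(2)[of q] q by (simp add: powr_divide)
  finally have "0 \<le> crit_gap q q" using l by (simp add: crit_gap_def flip: l_def)
  moreover have neg: "crit_gap q 1 < 0" using q by (simp add: crit_gap_def)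
  moreover have "continuous_on {q..1} (crit_gap q)"
  proof -
    have "0 \<le> 1 - l * x" if "x \<in> {q..1}" for x
      using that l q mult_le_one[of l x] by auto
    then show ?thesis
      unfolding crit_gap_def l_def[symmetric] using q
      by (intro continuous_intros continuous_on_powr') auto
  qed
  ultimately obtain \<alpha> where \<alpha>: "q \<le> \<alpha>" "\<alpha> \<le> 1" "crit_gap q \<alpha> = 0"
    using IVT2'[of "crit_gap q" 1 0 q] q by auto
  then have "\<alpha> < 1" using neg by (cases "\<alpha> = 1") auto
  with \<alpha> that show ?thesis by blast
qed

lemma geo_strict_mono:
  assumes "0 < q" "q < 1" "a < 1" "0 \<le> g" "g < h"
  shows "geo_const q * (1 - a) powr (1 - q) * g powr q < geo_const q * (1 - a) powr (1 - q) * h powr q"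
  using assms geo_const_pos[of q] by (intro mult_strict_left_mono powr_less_mono2 mult_pos_pos) auto

text \<open>The left side of \<open>star\<close> increases in \<open>g\<close> and the right side
  decreases. A nonnegative gap says that the left side has already caught up on the critical line,
  so the crossing is not beyond it.\<close>

lemma star_le_crit_line:
  assumes q: "0 < q" "q \<le> 1/2" and ag: "0 < a" "a < 1" and gap: "0 \<le> crit_gap q a"
    and star: "geo_const q * (1 - a) powr (1 - q) * g powr q = 1 + a - g"
  shows "(1 - q) * (1 - g) \<ge> q * a"
proof (rule ccontr)
  assume n: "\<not> ?thesis"
  define h where "h = 1 - q / (1 - q) * a"
  have hg: "h < g" using n q by (simp add: h_def field_simps)
  have "1 + a - h = a / (1 - q)" using q by (simp add: h_def field_simps)
  then have le: "1 + a - h \<le> geo_const q * (1 - a) powr (1 - q) * h powr q"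
    using gap by (simp add: crit_gap_def h_def)
  have "q / (1 - q) * a \<le> 1 * a" using q ag by (intro mult_right_mono) auto
  then have "0 < h" using ag by (simp add: h_def)
  then show False using geo_strict_mono[of q a h g] le star hg q ag by simp
qed

text \<open>The right-hand disjuncts are the two arcs of the curve on which the envelopes agree: both
  envelopes are geometric means on the first, the second envelope is linear on the second.\<close>

lemma touching_iff:
  assumes q: "0 < q" "q \<le> 1/2" and ag: "0 < a" "a < 1" "0 < g" "g < 1"
    and \<alpha>: "q \<le> \<alpha>" "\<alpha> < 1" "crit_gap q \<alpha> = 0"
  shows "b = env q (1 - a) g \<and> b = env (1 - q) (1 - g) a \<and> q * (1 - a) \<le> (1 - q) * g \<longleftrightarrow>
    \<alpha> \<le> a \<and> b = geo_const q * (1 - a) powr (1 - q) * g powr q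
      \<and> b = geo_const q * (1 - g) powr q * a powr (1 - q) \<or>
    q \<le> a \<and> a \<le> \<alpha> \<and> b = geo_const q * (1 - a) powr (1 - q) * g powr q \<and> b = 1 + a - g"
    (is "?L \<longleftrightarrow> ?R1 \<or> ?R2")
proof -
  define l where "l = q / (1 - q)"
  have l: "0 < l" "l \<le> 1" using q by (auto simp: l_def field_simps)
  have q1: "q < 1" using q by simp
  let ?X = "\<lambda>g. geo_const q * (1 - a) powr (1 - q) * g powr q"
  let ?Y = "\<lambda>g. geo_const q * (1 - g) powr q * a powr (1 - q)"
  \<comment> \<open>For fixed \<open>a\<close>, the second envelope changes regime at
    \<open>g0\<close> and the first at \<open>g2\<close>; here \<open>g2 \<le> g0\<close> because
    \<open>l \<le> 1\<close>.\<close>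
  define g0 where "g0 = 1 - l * a"
  define g2 where "g2 = l * (1 - a)"
  have la: "l * a \<le> a" "0 < l * a" using l ag by (auto simp: mult_left_le_one_le)
  then have g0: "0 < g0" "g0 < 1" unfolding g0_def using ag by linarith+
  have g2: "0 < g2" using l ag by (simp add: g2_def)
  have X_mono: "?X x < ?X y" if "0 \<le> x" "x < y" for x y
    using geo_strict_mono[OF q(1) q1 ag(2) that] .
  have Y_mono: "?Y y < ?Y x" if "x < y" "y \<le> 1" for x y
    using that q ag geo_const_pos[of q]
    by (intro mult_strict_right_mono mult_strict_left_mono powr_less_mono2) auto
  have split: "x powr q * x powr (1 - q) = x" if "0 < x" for x
    using that by (simp flip: powr_add)
  have Y0: "?Y g0 = a / (1 - q)"
  proof -
    have "?Y g0 = geo_const q * l powr q * (a powr q * a powr (1 - q))"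
      by (simp add: g0_def powr_mult)
    then show ?thesis using geo_const_powr(1)[of q] q split[of a] ag by (simp add: l_def)
  qed
  have X2: "?X g2 = (1 - a) / (1 - q)"
  proof -
    have "?X g2 = geo_const q * l powr q * ((1 - a) powr q * (1 - a) powr (1 - q))"
      by (simp add: g2_def powr_mult)
    then show ?thesis using geo_const_powr(1)[of q] q split[of "1 - a"] ag by (simp add: l_def)
  qed
  \<comment> \<open>The gap compares the increasing \<open>?X\<close> with the second envelope at
    \<open>g0\<close>, so its sign tells on which side of \<open>g0\<close> they cross.\<close>
  have gap: "crit_gap q a = ?X g0 - a / (1 - q)" by (simp add: crit_gap_def g0_def l_def)
  have lin0: "1 + a - g0 = a / (1 - q)" using q by (simp add: g0_def l_def field_simps)
  \<comment> \<open>Origin of the endpoint \<open>q\<close>: at \<open>g2\<close> the first envelope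
    lies below the line \<open>1 + a - g\<close> exactly when \<open>q \<le> a\<close>.\<close>
  have lin2: "(1 - a) / (1 - q) \<le> 1 + a - g2 \<longleftrightarrow> q \<le> a"
  proof -
    have d: "x / (1 - q) = x * (1 + l)" for x using q by (simp add: l_def field_simps)
    have "q * (1 + l) = l" using d[of q] by (simp add: l_def)
    then have "(1 - a) / (1 - q) - (1 + a - g2) = 2 * (q - a) / (1 - q)"
      by (simp add: g2_def d algebra_simps)
    moreover have "2 * (q - a) / (1 - q) \<le> 0 \<longleftrightarrow> q \<le> a" using q by (simp add: divide_le_0_iff)
    ultimately show ?thesis by linarith
  qed
  have g0_iff: "g0 \<le> g \<longleftrightarrow> (1 - q) * (1 - g) \<le> q * a" "g \<le> g0 \<longleftrightarrow> q * a \<le> (1 - q) * (1 - g)"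
    using q by (auto simp: g0_def l_def field_simps)
  have g2_iff: "g2 \<le> g \<longleftrightarrow> q * (1 - a) \<le> (1 - q) * g"
    using q by (auto simp: g2_def l_def field_simps)
  have envX: "env q (1 - a) g = ?X g" if "g2 \<le> g"
    using env_geometric[of q "1 - a" g] q ag that g2_iff by simp
  have envY: "env (1 - q) (1 - g) a = ?Y g" if "g0 \<le> g"
    using env_geometric[of "1 - q" "1 - g" a] q ag that g0_iff by (simp add: geo_const_swap)
  have envL: "env (1 - q) (1 - g) a = 1 + a - g" if "g \<le> g0"
    using env_linear[of "1 - q" a "1 - g"] q ag that g0_iff by simp
  have gap_pos: "0 < crit_gap q a" if "a < \<alpha>"
    using crit_gap_strict_antimono[of q a \<alpha>] q \<alpha> that ag by simp
  have gap_neg: "crit_gap q a < 0" if "\<alpha> < a"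
    using crit_gap_strict_antimono[of q \<alpha> a] q \<alpha> that ag by simp
  have X_le: "?X x \<le> ?X y" if "0 \<le> x" "x \<le> y" for x y
    using X_mono[of x y] that by (cases "x = y") auto
  have Y_le: "?Y y \<le> ?Y x" if "x \<le> y" "y \<le> 1" for x y
    using Y_mono[of x y] that by (cases "x = y") auto
  show ?thesis
  proof
    assume L: ?L
    then have gg2: "g2 \<le> g" by (simp add: g2_iff)
    then have bX: "b = ?X g" using L envX by simp
    show "?R1 \<or> ?R2"
    proof (cases "g0 \<le> g")
      case True
      then have bY: "b = ?Y g" using L envY by simp
      have "\<not> a < \<alpha>"
        using gap_pos gap X_le[of g0 g] Y_le[of g0 g] Y0 True g0 ag bX bY by force
      then show ?thesis using bX bY by simp
    next
      case False
      then have bL: "b = 1 + a - g" using L envL by simp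
      have "\<not> \<alpha> < a" using gap_neg gap X_le[of g g0] lin0 False ag bX bL by force
      moreover have "q \<le> a" using X_le[of g2 g] X2 lin2 g2 gg2 bX bL by force
      ultimately show ?thesis using bX bL by simp
    qed
  next
    assume "?R1 \<or> ?R2"
    then show ?L
    proof
      assume R: ?R1
      then have "crit_gap q a \<le> 0" using gap_neg \<alpha> by (cases "\<alpha> = a") auto
      then have "?X g0 \<le> ?Y g0" using gap Y0 by simp
      then have gg0: "g0 \<le> g" using X_mono[of g g0] Y_mono[of g g0] g0 ag R by force
      have "g2 \<le> g0" using q by (simp add: g2_def g0_def algebra_simps l)
      with gg0 have "env q (1 - a) g = ?X g" "env (1 - q) (1 - g) a = ?Y g" "g2 \<le> g"
        using envX envY by auto
      then show ?thesis using R g2_iff by metis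
    next
      assume R: ?R2
      then have "0 \<le> crit_gap q a" using gap_pos \<alpha> by (cases "\<alpha> = a") auto
      then have "g \<le> g0" using star_le_crit_line[of q a g] q ag R g0_iff by simp
      \<comment> \<open>If \<open>g < g2\<close>, then \<open>?X g\<close> is below
        \<open>?X g2\<close>, which is at most \<open>1 + a - g2\<close> and hence below
        \<open>1 + a - g\<close>.\<close>
      moreover have "g2 \<le> g"
        using X_mono[of g g2] X2 lin2 R ag by force
      ultimately have "env q (1 - a) g = ?X g" "env (1 - q) (1 - g) a = 1 + a - g" "g2 \<le> g"
        using envX envL by auto
      then show ?thesis using R g2_iff by metis
    qed
  qed
qed

text \<open>Moving \<open>g\<close> to the left gives a continuous strictly increasing function,
  running from 0 at 0 to at least \<open>1 + a\<close>.\<close>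

lemma star_ex1:
  assumes q: "0 < q" "q < 1" and a: "0 < a" "a < 1"
  shows "\<exists>!g. 0 < g \<and> geo_const q * (1 - a) powr (1 - q) * g powr q = 1 + a - g"
proof (rule ex_ex1I)
  let ?f = "\<lambda>g. geo_const q * (1 - a) powr (1 - q) * g powr q + g"
  have "continuous_on {0..1 + a} ?f"
    using q by (intro continuous_intros continuous_on_powr') auto
  moreover have "1 + a \<le> ?f (1 + a)" using geo_const_pos[OF q] by simp
  moreover have "?f 0 \<le> 1 + a" using q a by simp
  ultimately obtain g where g: "0 \<le> g" "?f g = 1 + a"
    using IVT'[of ?f 0 "1 + a" "1 + a"] a by auto
  then have "g \<noteq> 0" using q a by auto
  with g show "\<exists>g. 0 < g \<and> geo_const q * (1 - a) powr (1 - q) * g powr q = 1 + a - g"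
    by (intro exI[of _ g]) auto
  fix g h
  assume "0 < g \<and> geo_const q * (1 - a) powr (1 - q) * g powr q = 1 + a - g"
    "0 < h \<and> geo_const q * (1 - a) powr (1 - q) * h powr q = 1 + a - h"
  then show "g = h"
    using geo_strict_mono[OF q a(2), of g h] geo_strict_mono[OF q a(2), of h g]
    by (cases g h rule: linorder_cases) auto
qed

text \<open>\<open>u\<close> and \<open>v\<close> are chosen so that both sides are the same
  multiple of \<open>q\<close>-th powers; comparing the bases leaves a linear equation in
  \<open>g\<close>.\<close>

lemma geometric_arc_iff:
  assumes q: "0 < q" "q < 1" and ag: "0 < a" "a < 1" "0 < g" "g < 1"
  defines "u \<equiv> (1 - a) powr ((1 - q) / q)" and "v \<equiv> a powr ((1 - q) / q)"
  shows "geo_const q * (1 - a) powr (1 - q) * g powr q = geo_const q * (1 - g) powr q * a powr (1 - q)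
    \<longleftrightarrow> g = v / (u + v)"
proof -
  have uv: "0 < u" "0 < v" using ag by (auto simp: u_def v_def)
  have uq: "u powr q = (1 - a) powr (1 - q)" "v powr q = a powr (1 - q)"
    using q by (simp_all add: u_def v_def powr_powr)
  have "geo_const q * (1 - a) powr (1 - q) * g powr q = geo_const q * (1 - g) powr q * a powr (1 - q)
    \<longleftrightarrow> (u * g) powr q = ((1 - g) * v) powr q"
    using geo_const_pos[OF q] by (simp add: powr_mult uq)
  also have "\<dots> \<longleftrightarrow> u * g = (1 - g) * v"
    using powr_less_mono2[of q "u * g" "(1 - g) * v"] powr_less_mono2[of q "(1 - g) * v" "u * g"]
      uv q ag by (cases "u * g" "(1 - g) * v" rule: linorder_cases) auto
  also have "\<dots> \<longleftrightarrow> g = v / (u + v)"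
    using uv by (simp add: field_simps)
  finally show ?thesis .
qed

section \<open>Parametrization\<close>

lemma power_eq_powr_power:
  assumes "0 \<le> x" "0 < m" "0 < k"
  shows "x ^ k = (x ^ m) powr (real k / real m)"
proof (cases "x = 0")
  case False
  then show ?thesis using assms by (simp add: powr_powr flip: powr_realpow)
qed (use assms in \<open>simp add: zero_power\<close>)

text \<open>Compactness of the square bounds the image, so that \<open>SUP\<close> is a genuine
  supremum.\<close>

lemma trinom_norm_le_iff:
  "trinom_norm m n (a, b, c) \<le> u \<longleftrightarrow>
    (\<forall>x\<in>{-1..1}. \<forall>y\<in>{-1..1}. \<bar>a * x ^ m + b * x ^ (m - n) * y ^ n + c * y ^ m\<bar> \<le> u)"
proof -
  let ?f = "\<lambda>(x, y). \<bar>a * x ^ m + b * x ^ (m - n) * y ^ n + c * y ^ m\<bar>"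
  have "compact (?f ` ({-1..1} \<times> {-1..1}))"
    unfolding case_prod_unfold
    by (intro compact_continuous_image continuous_intros compact_Times compact_Icc)
  then have "bdd_above (?f ` ({-1..1} \<times> {-1..1}))"
    by (simp add: bounded_imp_bdd_above compact_imp_bounded)
  then show ?thesis
    unfolding trinom_norm_def case_prod_conv by (subst cSUP_le_iff) auto
qed

lemma trinom_ball_eq_wball:
  assumes n: "0 < n" "n < m" and "even m" "odd n"
  shows "trinom_ball m n = wball (real n / real m)"
proof -
  define q where "q = real n / real m"
  have p: "real (m - n) / real m = 1 - q"
    using n by (simp add: q_def of_nat_diff diff_divide_distrib)
  have pw: "x ^ (m - n) = (x ^ m) powr (1 - q)" "x ^ n = (x ^ m) powr q" if "0 \<le> x" for x
    using power_eq_powr_power[OF that, of m "m - n"] power_eq_powr_power[OF that, of m n] n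
    unfolding p q_def by auto
  have "trinom_norm m n (a, b, c) \<le> 1 \<longleftrightarrow> (a, b, c) \<in> wball q" for a b c
    unfolding trinom_norm_le_iff
  proof
    assume *: "\<forall>x\<in>{-1..1}. \<forall>y\<in>{-1..1}. \<bar>a * x ^ m + b * x ^ (m - n) * y ^ n + c * y ^ m\<bar> \<le> 1"
    have "\<bar>a * s + c * t\<bar> + \<bar>b\<bar> * (s powr (1 - q) * t powr q) \<le> 1"
      if st: "s \<in> {0..1}" "t \<in> {0..1}" for s t
    proof -
      define x where "x = root m s"
      define y where "y = root m t"
      have x: "0 \<le> x" "x \<le> 1" "x ^ m = s" and y: "0 \<le> y" "y \<le> 1" "y ^ m = t"
        using st n by (auto simp: x_def y_def)
      let ?w = "s powr (1 - q) * t powr q"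
      \<comment> \<open>Evaluate at \<open>y\<close> and at \<open>- y\<close>: as \<open>m\<close>
        is even and \<open>n\<close> odd, only the middle term changes sign.\<close>
      have "\<bar>a * s + b * ?w + c * t\<bar> \<le> 1" "\<bar>a * s - b * ?w + c * t\<bar> \<le> 1"
        using *[rule_format, of x y] *[rule_format, of x "- y"] x y pw[of x] pw[of y] assms(3,4)
        by (auto simp: mult.assoc)
      moreover have "\<bar>b\<bar> * ?w = \<bar>b * ?w\<bar>" by (simp add: abs_mult)
      ultimately show ?thesis by linarith
    qed
    then show "(a, b, c) \<in> wball q" by (simp add: wball_def)
  next
    assume W: "(a, b, c) \<in> wball q"
    show "\<forall>x\<in>{-1..1}. \<forall>y\<in>{-1..1}. \<bar>a * x ^ m + b * x ^ (m - n) * y ^ n + c * y ^ m\<bar> \<le> 1"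
    proof (intro ballI)
      fix x y :: real assume xy: "x \<in> {-1..1}" "y \<in> {-1..1}"
      have bd: "x ^ m \<in> {0..1}" "y ^ m \<in> {0..1}"
        using xy assms(3) power_le_one[of "\<bar>x\<bar>" m] power_le_one[of "\<bar>y\<bar>" m]
        by (auto simp: power_even_abs zero_le_even_power)
      have "\<bar>b * x ^ (m - n) * y ^ n\<bar> = \<bar>b\<bar> * (\<bar>x\<bar> ^ (m - n) * \<bar>y\<bar> ^ n)"
        by (simp add: abs_mult power_abs)
      also have "\<dots> = \<bar>b\<bar> * ((x ^ m) powr (1 - q) * (y ^ m) powr q)"
        using pw[of "\<bar>x\<bar>"] pw[of "\<bar>y\<bar>"] assms(3) by (simp add: power_even_abs)
      finally show "\<bar>a * x ^ m + b * x ^ (m - n) * y ^ n + c * y ^ m\<bar> \<le> 1"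
        using wballD[OF W, of "x ^ m" "y ^ m"] bd by auto
    qed
  qed
  then show ?thesis by (auto simp: trinom_ball_def q_def)
qed

lemma J_eq_geo_const:
  assumes "0 < n" "n < m"
  shows "J m n = geo_const (real n / real m)"
proof -
  define q where "q = real n / real m"
  have q: "0 < q" "q < 1" using assms by (auto simp: q_def)
  have e: "real m / real n = 1 / q" "real n / (real m - real n) = q / (1 - q)"
    "(real m - real n) / real m = 1 - q"
    using assms by (auto simp: q_def field_simps)
  have "q powr q * q powr (1 - q) = q" using q by (simp flip: powr_add)
  then have "J m n = 1 / (q powr q * q powr (1 - q)) * (q powr (1 - q) / (1 - q) powr (1 - q))"
    unfolding J_def e by (simp add: powr_divide)
  also have "\<dots> = geo_const q" using q by (simp add: geo_const_def)
  finally show ?thesis by (simp add: q_def)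
qed

lemma star_eq_iff:
  assumes "0 < n" "n < m"
  shows "star_eq m n a (- g) \<longleftrightarrow> geo_const (real n / real m) * (1 - a) powr (1 - real n / real m)
    * \<bar>g\<bar> powr (real n / real m) = 1 + a - g"
  using assms by (auto simp: star_eq_def J_eq_geo_const diff_divide_distrib)

lemma a1_props:
  assumes n: "0 < n" "2 * n \<le> m"
  shows "real n / real m \<le> a1 m n" "a1 m n < 1" "crit_gap (real n / real m) (a1 m n) = 0"
proof -
  define q where "q = real n / real m"
  have nm: "n < m" using n by simp
  have q: "0 < q" "q \<le> 1/2" using n by (auto simp: q_def field_simps)
  have l: "lambda0 m n = q / (1 - q)" using nm by (simp add: lambda0_def q_def field_simps)
  obtain \<alpha> where \<alpha>: "q \<le> \<alpha>" "\<alpha> < 1" "crit_gap q \<alpha> = 0" using crit_gap_root[OF q] .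
  \<comment> \<open>On the critical line the equation is the vanishing of the gap; the sign
    condition resolves the absolute value of \<open>c\<close>.\<close>
  have star: "star_eq m n a (lambda0 m n * a - 1) \<longleftrightarrow> crit_gap q a = 0"
    if "lambda0 m n * a - 1 < 0" for a
  proof -
    have "1 + a - (1 - q / (1 - q) * a) = a / (1 - q)" using q by (simp add: field_simps)
    then show ?thesis
      using star_eq_iff[OF n(1) nm, of a "1 - q / (1 - q) * a"] that
      by (simp add: l crit_gap_def flip: q_def)
  qed
  have "crit_point m n = (\<alpha>, lambda0 m n * \<alpha> - 1)"
    unfolding crit_point_def
  proof (rule the_equality)
    have "q / (1 - q) * \<alpha> \<le> 1 * \<alpha>" using q \<alpha> by (intro mult_right_mono) auto
    then have "lambda0 m n * \<alpha> - 1 < 0" unfolding l using \<alpha> by linarith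
    then show "case (\<alpha>, lambda0 m n * \<alpha> - 1) of (a, c) \<Rightarrow>
        a \<le> 1 \<and> c < 0 \<and> star_eq m n a c \<and> c = lambda0 m n * a - 1"
      using star \<alpha> by simp
    fix p assume "case p of (a, c) \<Rightarrow> a \<le> 1 \<and> c < 0 \<and> star_eq m n a c \<and> c = lambda0 m n * a - 1"
    then obtain a where p: "p = (a, lambda0 m n * a - 1)" and a: "a \<le> 1" and gap: "crit_gap q a = 0"
      using star by (cases p) auto
    \<comment> \<open>A root of the gap has \<open>a \<ge> 0\<close>, since the power term is
      nonnegative; this places it where the gap is strictly monotone.\<close>
    have "0 \<le> geo_const q * (1 - a) powr (1 - q) * (1 - q / (1 - q) * a) powr q"
      using geo_const_pos[of q] q by simp
    then have "0 \<le> a / (1 - q)" using gap by (simp add: crit_gap_def)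
    then have "0 \<le> a" using q by (simp add: zero_le_divide_iff)
    then have "a = \<alpha>"
      using crit_gap_strict_antimono[OF q, of a \<alpha>] crit_gap_strict_antimono[OF q, of \<alpha> a] a \<alpha> gap q
      by (cases a \<alpha> rule: linorder_cases) auto
    with p show "p = (\<alpha>, lambda0 m n * \<alpha> - 1)" by simp
  qed
  then have "a1 m n = \<alpha>" by (simp add: a1_def)
  with \<alpha> show "real n / real m \<le> a1 m n" "a1 m n < 1" "crit_gap (real n / real m) (a1 m n) = 0"
    by (auto simp: q_def)
qed

lemma Gam_eq_iff:
  assumes n: "0 < n" "n < m" and a: "0 < a" "a < 1"
  defines "q \<equiv> real n / real m"
  shows "c = Gam m n a \<longleftrightarrow> c < 0 \<and> geo_const q * (1 - a) powr (1 - q) * (- c) powr q = 1 + a + c"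
proof -
  let ?P = "\<lambda>c. c < 0 \<and> star_eq m n a c"
  have q: "0 < q" "q < 1" using n by (auto simp: q_def)
  have P: "?P c \<longleftrightarrow> 0 < - c \<and> geo_const q * (1 - a) powr (1 - q) * (- c) powr q = 1 + a - - c" for c
    using star_eq_iff[OF n, of a "- c"] by (auto simp flip: q_def)
  obtain g where "0 < g" "geo_const q * (1 - a) powr (1 - q) * g powr q = 1 + a - g"
    using star_ex1[OF q a] by blast
  then have "?P (- g)" using P[of "- g"] by simp
  moreover have "c = d" if "?P c" "?P d" for c d
    using star_ex1[OF q a] P that by (metis minus_minus)
  ultimately have "\<exists>!c. ?P c" by blast
  then have "c = Gam m n a \<longleftrightarrow> ?P c" unfolding Gam_def by (metis (no_types, lifting) theI')
  then show ?thesis using P by simp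
qed

text \<open>The critical line gives \<open>g < 1\<close>. For \<open>a \<le> g\<close>: the
  geometric mean at \<open>g = a\<close> is at most 1, the value bound at \<open>t = 1\<close>,
  whereas \<open>g < a\<close> would push it above \<open>1 + a - g > 1\<close>.\<close>

lemma linear_arc_bounds:
  assumes q: "0 < q" "q \<le> 1/2" and a: "q \<le> a" "a < 1" "0 < g" and gap: "0 \<le> crit_gap q a"
    and star: "geo_const q * (1 - a) powr (1 - q) * g powr q = 1 + a - g"
  shows "a \<le> g" "g < 1" "0 \<le> 1 + a - g"
proof -
  have "0 < q * a" using q a by simp
  also have "\<dots> \<le> (1 - q) * (1 - g)" using star_le_crit_line[OF q _ a(2) gap star] q a by simp
  finally show "g < 1" using q by (simp add: zero_less_mult_iff)
  show "0 \<le> 1 + a - g" using geo_const_pos[of q] q by (simp flip: star)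
  show "a \<le> g"
  proof (rule ccontr)
    assume "\<not> a \<le> g"
    then have "1 + a - g < geo_const q * (1 - a) powr (1 - q) * a powr q"
      using geo_strict_mono[of q a g a] q a star by simp
    also have "\<dots> = env q (1 - a) a"
      using env_geometric[of q "1 - a" a] q a by (simp add: algebra_simps)
    also have "\<dots> \<le> (1 - a) + a"
      using le_env_iff[of q "1 - a" a "env q (1 - a) a"] q a by (auto dest: bspec[of _ _ 1])
    finally show False using \<open>\<not> a \<le> g\<close> by simp
  qed
qed

lemma extreme_point_param_iff:
  assumes n: "0 < n" "2 * n \<le> m" and pos: "0 \<le> a" "0 \<le> b" "0 < a \<or> 0 \<le> c"
  defines "q \<equiv> real n / real m"
  shows "(a, b, c) extreme_point_of wball q \<longleftrightarrow> (a, b, c) \<in> {(1, 0, 0), (0, 0, 1)} \<or>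
    a \<in> {a1 m n..1} \<and> b = b_upper m n a \<and> c = c_upper m n a \<or>
    a \<in> {q..a1 m n} \<and> b = 1 - \<bar>a + Gam m n a\<bar> \<and> c = Gam m n a"
    (is "_ \<longleftrightarrow> ?V \<or> ?A1 \<or> ?A2")
proof -
  have nm: "n < m" using n by simp
  have q: "0 < q" "q \<le> 1/2" using n by (auto simp: q_def field_simps)
  have q1: "q < 1" using q by simp
  have \<alpha>: "q \<le> a1 m n" "a1 m n < 1" "crit_gap q (a1 m n) = 0"
    using a1_props[OF n] by (auto simp: q_def)
  have e: "(real m - real n) / real m = 1 - q" "(real m - real n) / real n = (1 - q) / q"
    using n by (auto simp: q_def field_simps)
  define u where "u = (1 - a) powr ((1 - q) / q)"
  define v where "v = a powr ((1 - q) / q)"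
  have cu: "c_upper m n a = - (v / (u + v))"
    unfolding c_upper_def e u_def v_def ..
  \<comment> \<open>\<open>b_upper\<close> is the first geometric mean at
    \<open>g = v / (u + v)\<close>, because \<open>a powr (1 - q) = v powr q\<close>.\<close>
  have bu: "b_upper m n a = geo_const q * (1 - a) powr (1 - q) * (v / (u + v)) powr q"
  proof -
    have "(1 - a) powr (1 - q) = u powr q" "a powr (1 - q) = v powr q"
      using q by (simp_all add: u_def v_def powr_powr)
    then show ?thesis
      unfolding b_upper_def J_eq_geo_const[OF n(1) nm] e q_def[symmetric] u_def[symmetric] v_def[symmetric]
      by (simp add: powr_divide)
  qed
  note main = extreme_iff[OF q pos]
  show ?thesis
  proof (cases "0 < a \<and> a < 1")
    case False
    then consider "a = 1" | "a \<notin> {a1 m n..1}" "a \<notin> {q..a1 m n}" "a \<noteq> 1"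
      using pos \<alpha> q by (cases "a = 0") auto
    then show ?thesis
    proof cases
      case 1
      \<comment> \<open>As \<open>0 powr r = 0\<close>, the first arc ends in the corner
        \<open>(1, 0, - 1)\<close>.\<close>
      have "b_upper m n 1 = 0" "c_upper m n 1 = - 1" by (simp_all add: b_upper_def c_upper_def)
      with 1 \<alpha> show ?thesis unfolding main by auto
    next
      case 2
      then show ?thesis unfolding main using False by auto
    qed
  next
    case True
    then have a: "0 < a" "a < 1" by auto
    have uv: "0 < u" "0 < v" using a by (auto simp: u_def v_def)
    let ?X = "geo_const q * (1 - a) powr (1 - q) * (- c) powr q"
    let ?Y = "geo_const q * (1 - - c) powr q * a powr (1 - q)"
    have Xpos: "0 \<le> ?X" using geo_const_pos[OF q(1) q1] by simp
    have A1: "?A1 \<longleftrightarrow> - 1 < c \<and> c < 0 \<and> a1 m n \<le> a \<and> b = ?X \<and> b = ?Y"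
    proof -
      have "?X = ?Y \<longleftrightarrow> - c = v / (u + v)" if "- 1 < c" "c < 0"
        using geometric_arc_iff[OF q(1) q1 a, of "- c"] that by (simp add: u_def v_def)
      moreover have "- 1 < c_upper m n a" "c_upper m n a < 0" using uv by (auto simp: cu)
      ultimately show ?thesis using cu bu a by auto
    qed
    \<comment> \<open>On this arc \<open>a \<le> - c\<close>, so
      \<open>1 - \<bar>a + c\<bar>\<close> is the linear value \<open>1 + a + c\<close>.\<close>
    have A2: "?A2 \<longleftrightarrow> - 1 < c \<and> c < 0 \<and> q \<le> a \<and> a \<le> a1 m n \<and> b = ?X \<and> b = 1 + a - - c"
    proof (cases "q \<le> a \<and> a \<le> a1 m n \<and> c < 0 \<and> ?X = 1 + a + c")
      case True
      have "0 \<le> crit_gap q a"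
        using crit_gap_strict_antimono[OF q, of a "a1 m n"] \<alpha> True a by (cases "a = a1 m n") auto
      then have "a \<le> - c" "- c < 1"
        using linear_arc_bounds[OF q, of a "- c"] True a by auto
      then show ?thesis using Gam_eq_iff[OF n(1) nm a, of c] True by (auto simp flip: q_def)
    next
      case False
      then show ?thesis using Gam_eq_iff[OF n(1) nm a, of c] by (auto simp flip: q_def)
    qed
    have "(a, b, c) extreme_point_of wball q \<longleftrightarrow> - 1 < c \<and> c < 0 \<and>
        (b = env q (1 - a) (- c) \<and> b = env (1 - q) (1 - - c) a \<and> q * (1 - a) \<le> (1 - q) * (- c))"
      unfolding main using a by auto
    also have "\<dots> \<longleftrightarrow> ?A1 \<or> ?A2"
      using touching_iff[OF q a _ _ \<alpha>, of "- c" b] unfolding A1 A2 by auto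
    finally show ?thesis using a by auto
  qed
qed

text \<open>Together with \<open>Gam_b_nonneg\<close>, this places the listed arcs in the region
  \<open>b \<ge> 0\<close> where the classification applies.\<close>

lemma b_upper_nonneg:
  assumes "0 < n" "n < m"
  shows "0 \<le> b_upper m n a"
  using geo_const_pos[of "real n / real m"] assms by (simp add: b_upper_def J_eq_geo_const)

lemma Gam_b_nonneg:
  assumes n: "0 < n" "2 * n \<le> m" and a: "real n / real m \<le> a" "a \<le> a1 m n"
  shows "0 \<le> 1 - \<bar>a + Gam m n a\<bar>"
proof -
  define q where "q = real n / real m"
  have q: "0 < q" "q \<le> 1/2" using n by (auto simp: q_def field_simps)
  have \<alpha>: "a1 m n < 1" "crit_gap q (a1 m n) = 0" using a1_props[OF n] by (auto simp: q_def)
  have a': "q \<le> a" "0 < a" "a < 1" using a q \<alpha> unfolding q_def[symmetric] by auto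
  have "0 \<le> crit_gap q a"
    using crit_gap_strict_antimono[OF q, of a "a1 m n"] \<alpha> a a' by (cases "a = a1 m n") auto
  then have "a \<le> - Gam m n a" "0 \<le> 1 + a - - Gam m n a"
    using Gam_eq_iff[of n m a "Gam m n a"] linear_arc_bounds[OF q a'(1,3), of "- Gam m n a"] n a'
    by (auto simp flip: q_def)
  then show ?thesis by simp
qed

theorem theorem4p1:
  fixes m n :: nat
  assumes "0 < m" and "0 < n" and "2 * n \<le> m" and "even m" and "odd n"
  shows "{p. p extreme_point_of trinom_ball m n} =
      {s *\<^sub>R (1, 0, 0) | s. s \<in> {1, -1}}
    \<union> {s *\<^sub>R (0, 0, 1) | s. s \<in> {1, -1}}
    \<union> {s *\<^sub>R (a, t * b_upper m n a, c_upper m n a)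
        | s t a. s \<in> {1, -1} \<and> t \<in> {1, -1} \<and> a \<in> {a1 m n..1}}
    \<union> {s *\<^sub>R (a, t * (1 - \<bar>a + Gam m n a\<bar>), Gam m n a)
        | s t a. s \<in> {1, -1} \<and> t \<in> {1, -1} \<and> a \<in> {real n / real m..a1 m n}}"
proof -
  define q where "q = real n / real m"
  have nm: "n < m" using assms by simp
  have ball: "trinom_ball m n = wball q"
    using trinom_ball_eq_wball[OF assms(2) nm assms(4,5)] by (simp add: q_def)
  have a1: "q \<le> a1 m n" "a1 m n < 1" "0 < q"
    using a1_props[OF assms(2,3)] assms by (auto simp: q_def)
  \<comment> \<open>The representatives of the listed points, before signs are applied.\<close>
  define P where "P = (\<lambda>a b c. (a, b, c) = (1, 0, 0) \<or> (a, b, c) = (0, 0, 1) \<or>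
    a \<in> {a1 m n..1} \<and> b = b_upper m n a \<and> c = c_upper m n a \<or>
    a \<in> {q..a1 m n} \<and> b = 1 - \<bar>a + Gam m n a\<bar> \<and> c = Gam m n a)"
  have P_iff: "(a, b, c) extreme_point_of trinom_ball m n \<longleftrightarrow> P a b c"
    if "0 \<le> a" "0 \<le> b" "0 < a \<or> 0 \<le> c" for a b c
    using extreme_point_param_iff[OF assms(2,3) that] by (simp add: ball P_def flip: q_def)
  have P_pos: "0 \<le> a \<and> 0 \<le> b \<and> (0 < a \<or> 0 \<le> c)" if "P a b c" for a b c
    using that a1 b_upper_nonneg[OF assms(2) nm, of a] Gam_b_nonneg[OF assms(2,3), of a]
    by (auto simp: P_def q_def)
  have sym: "s *\<^sub>R (a, t * b, c) extreme_point_of trinom_ball m n \<longleftrightarrow>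
      (a, b, c) extreme_point_of trinom_ball m n" if "s \<in> {1, - 1}" "t \<in> {1, - 1}" for s t a b c
    using that by (auto simp: ball extreme_uminus_iff extreme_flip_iff
        extreme_uminus_iff[of _ "- b" for b, simplified])
  have "{p. p extreme_point_of trinom_ball m n} =
      {s *\<^sub>R (a, t * b, c) | s t a b c. s \<in> {1, - 1} \<and> t \<in> {1, - 1} \<and> P a b c}" (is "?E = ?S")
  proof (intro equalityI subsetI)
    fix p assume "p \<in> ?S"
    then obtain s t a b c where p: "p = s *\<^sub>R (a, t * b, c)" "s \<in> {1, - 1}" "t \<in> {1, - 1}" "P a b c"
      by blast
    then show "p \<in> ?E" using sym[OF p(2,3)] P_iff[of a b c] P_pos[OF p(4)] by simp
  next
    fix p assume "p \<in> ?E"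
    then obtain a b c where p: "p = (a, b, c)" and ext: "(a, b, c) extreme_point_of trinom_ball m n"
      by (cases p) auto
    \<comment> \<open>\<open>s\<close> makes the first coefficient nonnegative, or the last one if
      the first is zero; \<open>t\<close> then records the sign of the middle one.\<close>
    define s :: real where "s = (if 0 < a \<or> a = 0 \<and> 0 \<le> c then 1 else - 1)"
    define t :: real where "t = (if 0 \<le> s * b then 1 else - 1)"
    have st: "s \<in> {1, - 1}" "t \<in> {1, - 1}" by (auto simp: s_def t_def)
    have eq: "p = s *\<^sub>R (s * a, t * \<bar>s * b\<bar>, s * c)" by (auto simp: p s_def t_def)
    have "0 \<le> s * a" "0 < s * a \<or> 0 \<le> s * c" by (auto simp: s_def)
    moreover have "(s * a, \<bar>s * b\<bar>, s * c) extreme_point_of trinom_ball m n"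
      using sym[OF st, of "s * a" "\<bar>s * b\<bar>" "s * c"] ext
      unfolding p[symmetric] eq[symmetric] by simp
    ultimately have "P (s * a) \<bar>s * b\<bar> (s * c)" using P_iff by simp
    then show "p \<in> ?S" using eq st by blast
  qed
  also have "\<dots> =
      {s *\<^sub>R (1, 0, 0) | s. s \<in> {1, -1}}
    \<union> {s *\<^sub>R (0, 0, 1) | s. s \<in> {1, -1}}
    \<union> {s *\<^sub>R (a, t * b_upper m n a, c_upper m n a)
        | s t a. s \<in> {1, -1} \<and> t \<in> {1, -1} \<and> a \<in> {a1 m n..1}}
    \<union> {s *\<^sub>R (a, t * (1 - \<bar>a + Gam m n a\<bar>), Gam m n a)
        | s t a. s \<in> {1, -1} \<and> t \<in> {1, -1} \<and> a \<in> {real n / real m..a1 m n}}"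
    (is "_ = ?V1 \<union> ?V2 \<union> ?A1 \<union> ?A2")
  proof (intro equalityI subsetI)
    fix p assume "p \<in> {s *\<^sub>R (a, t * b, c) | s t a b c. s \<in> {1, - 1} \<and> t \<in> {1, - 1} \<and> P a b c}"
    then obtain s t a b c where p: "p = s *\<^sub>R (a, t * b, c)" "s \<in> {1, - 1}" "t \<in> {1, - 1}"
      and P: "P a b c" by blast
    from P[unfolded P_def] consider "(a, b, c) = (1, 0, 0)" | "(a, b, c) = (0, 0, 1)"
      | "a \<in> {a1 m n..1}" "b = b_upper m n a" "c = c_upper m n a"
      | "a \<in> {real n / real m..a1 m n}" "b = 1 - \<bar>a + Gam m n a\<bar>" "c = Gam m n a"
      unfolding q_def by blast
    then show "p \<in> ?V1 \<union> ?V2 \<union> ?A1 \<union> ?A2"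
    proof cases
      case 1
      then have "p = s *\<^sub>R (1, 0, 0)" using p by simp
      then show ?thesis using p by blast
    next
      case 2
      then have "p = s *\<^sub>R (0, 0, 1)" using p by simp
      then show ?thesis using p by blast
    qed (use p in blast)+
  next
    let ?S = "{s *\<^sub>R (a, t * b, c) | s t a b c. s \<in> {1, - 1} \<and> t \<in> {1, - 1} \<and> P a b c}"
    have S: "s *\<^sub>R (a, t * b, c) \<in> ?S" if "s \<in> {1, - 1}" "t \<in> {1, - 1}" "P a b c" for s t a b c
      using that by blast
    fix p assume "p \<in> ?V1 \<union> ?V2 \<union> ?A1 \<union> ?A2"
    then consider "p \<in> ?V1" | "p \<in> ?V2" | "p \<in> ?A1" | "p \<in> ?A2" by blast
    then show "p \<in> ?S"
    proof cases
      case 1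
      then obtain s where "p = s *\<^sub>R (1, 0, 0)" "s \<in> {1, - 1}" by blast
      \<comment> \<open>The middle coefficient is zero, so \<open>t = 1\<close> may be
        chosen.\<close>
      then show ?thesis using S[of s 1 1 0 0] by (simp add: P_def)
    next
      case 2
      then obtain s where "p = s *\<^sub>R (0, 0, 1)" "s \<in> {1, - 1}" by blast
      then show ?thesis using S[of s 1 0 0 1] by (simp add: P_def)
    next
      case 3
      then obtain s t a where "p = s *\<^sub>R (a, t * b_upper m n a, c_upper m n a)"
        "s \<in> {1, - 1}" "t \<in> {1, - 1}" "a \<in> {a1 m n..1}" by blast
      then show ?thesis using S[of s t a] by (simp add: P_def)
    next
      case 4
      then obtain s t a where "p = s *\<^sub>R (a, t * (1 - \<bar>a + Gam m n a\<bar>), Gam m n a)"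
        "s \<in> {1, - 1}" "t \<in> {1, - 1}" "a \<in> {q..a1 m n}" unfolding q_def by blast
      then show ?thesis using S[of s t a] by (simp add: P_def)
    qed
  qed
  finally show ?thesis .
qed

end
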